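(* Let $1<q<\infty$, let $\alpha=(\alpha_n)_{n\in\mathbb{N}}\in\ell^2$ and $f_\alpha(z)=\sum_{n\ge0}\alpha_n z^n$. The following statements are equivalent: (i) the Rhaly operator $R_\alpha$, $(R_\alpha f)(k)=\alpha_k\sum_{j=0}^k f(j)$, belongs to the Schatten class $\mathcal{S}^q(\ell^2)$; (ii) $f_\alpha$ belongs to the Besov space $\mathcal{B}^{2,q}_{1/2}$; (iii) $\displaystyle\sum_{n=0}^\infty\Big(2^n\sum_{j=2^n}^{2^{n+1}-1}|\alpha_j|^2\Big)^{q/2}<\infty$.
   Context: $\mathbb{N}=\{0,1,2,\dots\}$; $\ell^2$ is the Hilbert space of square-summable functions $\mathbb{N}\to\mathbb{C}$. For a bounded operator $T$ on $\ell^2$, the approximation numbers are $a_{n+1}(T)=\inf\{\|T-P\|: P \text{ linear on } \ell^2 \text{ with rank}\le n\}$, $n\ge0$, and $T\in\mathcal{S}^q(\ell^2)$ iff $(a_n(T))_{n\ge1}\in\ell^q$. The Besov space is $\mathcal{B}^{2,q}_{1/2}=\{f \text{ holomorphic on } \mathbb{D}: \int_0^1(1-r)^{q/2-1}\big(\int_0^{2\pi}|f'(re^{i\theta})|^2d\theta\big)^{q/2}r\,dr<\infty\}$. *)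

theory Defs
  imports "HOL-Analysis.Analysis" "HOL-Complex_Analysis.Complex_Analysis"
begin

definition is_l2 :: "(nat \<Rightarrow> complex) \<Rightarrow> bool" where
  "is_l2 f \<longleftrightarrow> summable (\<lambda>n. (cmod (f n))^2)"

definition l2norm :: "(nat \<Rightarrow> complex) \<Rightarrow> ereal" where
  "l2norm f = (if is_l2 f then ereal (sqrt (\<Sum>n. (cmod (f n))^2)) else \<infinity>)"

definition l2_linear :: "((nat \<Rightarrow> complex) \<Rightarrow> (nat \<Rightarrow> complex)) \<Rightarrow> bool" where
  "l2_linear T \<longleftrightarrow>
     (\<forall>f g. is_l2 f \<longrightarrow> is_l2 g \<longrightarrow> T (\<lambda>k. f k + g k) = (\<lambda>k. T f k + T g k)) \<and>
     (\<forall>c f. is_l2 f \<longrightarrow> T (\<lambda>k. c * f k) = (\<lambda>k. c * T f k))"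

definition op_norm :: "((nat \<Rightarrow> complex) \<Rightarrow> (nat \<Rightarrow> complex)) \<Rightarrow> ereal" where
  "op_norm T = (SUP f \<in> {f. is_l2 f \<and> l2norm f \<le> 1}. l2norm (T f))"

definition bounded_l2_op :: "((nat \<Rightarrow> complex) \<Rightarrow> (nat \<Rightarrow> complex)) \<Rightarrow> bool" where
  "bounded_l2_op T \<longleftrightarrow> l2_linear T \<and> (\<forall>f. is_l2 f \<longrightarrow> is_l2 (T f)) \<and> op_norm T < \<infinity>"

definition rank_le :: "((nat \<Rightarrow> complex) \<Rightarrow> (nat \<Rightarrow> complex)) \<Rightarrow> nat \<Rightarrow> bool" where
  "rank_le P n \<longleftrightarrow> (\<exists>v :: nat \<Rightarrow> nat \<Rightarrow> complex. \<forall>f. is_l2 f \<longrightarrow>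
      (\<exists>c :: nat \<Rightarrow> complex. P f = (\<lambda>k. \<Sum>i<n. c i * v i k)))"

definition approx_num :: "nat \<Rightarrow> ((nat \<Rightarrow> complex) \<Rightarrow> (nat \<Rightarrow> complex)) \<Rightarrow> ereal" where
  "approx_num m T = (INF P \<in> {P. l2_linear P \<and> rank_le P (m - 1)}. op_norm (\<lambda>f k. T f k - P f k))"

definition schatten :: "real \<Rightarrow> ((nat \<Rightarrow> complex) \<Rightarrow> (nat \<Rightarrow> complex)) \<Rightarrow> bool" where
  "schatten q T \<longleftrightarrow> bounded_l2_op T \<and>
     summable (\<lambda>n. (real_of_ereal (approx_num (Suc n) T)) powr q)"

definition rhaly :: "(nat \<Rightarrow> complex) \<Rightarrow> (nat \<Rightarrow> complex) \<Rightarrow> (nat \<Rightarrow> complex)" where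
  "rhaly \<alpha> f = (\<lambda>k. \<alpha> k * (\<Sum>j\<le>k. f j))"

definition besov_half :: "real \<Rightarrow> (complex \<Rightarrow> complex) \<Rightarrow> bool" where
  "besov_half q f \<longleftrightarrow> f holomorphic_on ball 0 1 \<and>
     (\<integral>\<^sup>+ r. indicator {0<..<1} r *
        ennreal ((1 - r) powr (q/2 - 1) *
          (integral {0..2*pi} (\<lambda>\<theta>. (cmod (deriv f (complex_of_real r * cis \<theta>)))^2)) powr (q/2) * r)
      \<partial>lborel) < \<infinity>"

end

theory Submission
  imports Defs
begin

text \<open>
  Write \<open>I(n)\<close> for the dyadic block \<open>[2\<^sup>n, 2\<^sup>n\<^sup>+\<^sup>1)\<close> and \<open>s(n)\<^sup>2 = 2\<^sup>n \<Sum>\<^bsub>j \<in> I(n)\<^esub> |\<alpha>\<^sub>j|\<^sup>2\<close>.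

  Besov norm: by Parseval the circle means of \<open>|f'|\<^sup>2\<close> are power series in \<open>r\<^sup>2\<close>, and for
  \<open>1 - r\<close> comparable to \<open>2\<^sup>-\<^sup>n\<close> they lie between multiples of \<open>2\<^sup>n s(n)\<^sup>2\<close> and of
  \<open>2\<^sup>n \<Sum>\<^sub>m 2\<^bsup>-|n-m|\<^esup> s(m)\<^sup>2\<close>; convolution with a geometric kernel preserves \<open>\<ell>\<^sup>p\<close> for all \<open>p > 0\<close>.

  Upper bound for approximation numbers: fix \<open>l > 0\<close>. The rows in blocks with \<open>s(n) \<le> l\<close> form an
  operator of norm \<open>O(l)\<close> by a dyadic Hardy inequality. Each remaining block is cut into \<open>O(s(n)/l)\<close>
  intervals on which the triangular part has norm at most \<open>l\<close>, and what lies outside these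
  triangles has rank one per interval. Hence at most \<open>O(\<Sum>\<^bsub>s(n) > l\<^esub> s(n)/l)\<close> approximation
  numbers exceed a multiple of \<open>l\<close>, and summing over \<open>l = 2\<^sup>-\<^sup>j\<close> gives \<open>O(\<Sum> s(n)\<^sup>q)\<close> as \<open>q > 1\<close>.

  Lower bound: the vectors \<open>h(n) = 1\<^bsub>I(n)\<^esub> - 1/4 1\<^bsub>I(n+2)\<^esub>\<close> have total sum zero, so along a residue
  class of \<open>n\<close> modulo 3 both they and their images have disjoint supports, and
  \<open>\<parallel>R h(n)\<parallel> \<ge> s(n+1) \<parallel>h(n)\<parallel> / 2\<close>. An operator of rank less than \<open>N\<close> annihilates a non-trivial
  combination of any \<open>N\<close> of them, so the \<open>N\<close>-th approximation number is at least half of the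
  \<open>N\<close>-th largest \<open>s(n+1)\<close> in the class.
\<close>

section \<open>Geometric convolutions\<close>

text \<open>The index 0 lies in no block, so later splittings of sums over all indices treat the
  term at 0 separately.\<close>

lemma sum_dyadic_blocks:
  fixes g :: "nat \<Rightarrow> 'a::comm_monoid_add"
  shows "sum g {1..<2 ^ N} = (\<Sum>m<N. sum g {2 ^ m..<2 ^ (m + 1)})"
proof (induction N)
  case 0
  then show ?case by simp
next
  case (Suc N)
  have "sum g {1..<2 ^ N} + sum g {2 ^ N..<2 ^ (N + 1)} = sum g {1..<2 ^ Suc N}"
    by (subst sum.atLeastLessThan_concat) auto
  with Suc show ?case by simp
qed

text \<open>Tonelli for the counting measure: reading the outer sum as an integral reduces the swap
  to termwise integration of a nonnegative series.\<close>

lemma suminf_ennreal_swap: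
  fixes f :: "nat \<Rightarrow> nat \<Rightarrow> ennreal"
  shows "(\<Sum>i. \<Sum>j. f i j) = (\<Sum>j. \<Sum>i. f i j)"
proof -
  have "(\<Sum>i. \<Sum>j. f i j) = (\<integral>\<^sup>+i. (\<Sum>j. f i j) \<partial>count_space UNIV)"
    by (simp add: nn_integral_count_space_nat)
  also have "\<dots> = (\<Sum>j. \<integral>\<^sup>+i. f i j \<partial>count_space UNIV)"
    by (rule nn_integral_suminf) simp
  finally show ?thesis by (simp add: nn_integral_count_space_nat)
qed

text \<open>With truncated subtraction the exponent is |n - m|. The terms with m < n and those with
  m \<ge> n each contribute at most one full geometric series, whence the factor 2, independent of
  n.\<close>

lemma geometric_dist_sums:
  fixes \<sigma> :: real
  assumes "0 < \<sigma>" "\<sigma> < 1"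
  shows "summable (\<lambda>m::nat. \<sigma> ^ ((n - m) + (m - n)))"
    and "(\<Sum>m::nat. \<sigma> ^ ((n - m) + (m - n))) \<le> 2 / (1 - \<sigma>)"
proof -
  let ?g = "\<lambda>m::nat. \<sigma> ^ ((n - m) + (m - n))"
  have geo: "summable (\<lambda>m. \<sigma> ^ m)" using assms by (intro summable_geometric) auto
  have tail: "(\<lambda>m. ?g (m + n)) = (\<lambda>m. \<sigma> ^ m)" by auto
  show summ: "summable ?g"
    using geo tail summable_iff_shift[of ?g n] by simp
  have "(\<Sum>m<n. ?g m) = (\<Sum>m<n. \<sigma> ^ Suc (n - Suc m))"
    by (intro sum.cong refl) (simp add: Suc_diff_Suc)
  also have "\<dots> = (\<Sum>m<n. \<sigma> ^ Suc m)"
    by (rule sum.nat_diff_reindex)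
  also have "\<dots> \<le> (\<Sum>m<n. \<sigma> ^ m)"
    using assms by (intro sum_mono) (simp add: mult_left_le_one_le)
  also have "\<dots> \<le> (\<Sum>m. \<sigma> ^ m)"
    using geo assms by (intro sum_le_suminf) auto
  finally have "(\<Sum>m<n. ?g m) \<le> 1 / (1 - \<sigma>)"
    using assms by (simp add: suminf_geometric)
  moreover have "suminf ?g = (\<Sum>m. ?g (m + n)) + (\<Sum>m<n. ?g m)"
    by (rule suminf_split_initial_segment[OF summ])
  moreover have "(\<Sum>m. ?g (m + n)) = 1 / (1 - \<sigma>)"
    using assms unfolding tail by (simp add: suminf_geometric)
  ultimately show "suminf ?g \<le> 2 / (1 - \<sigma>)" by simp
qed

lemma summable_le_suminf_ennreal:
  fixes f :: "nat \<Rightarrow> real"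
  assumes "\<And>n. 0 \<le> f n" "(\<Sum>n. ennreal (f n)) \<le> ennreal C" "0 \<le> C"
  shows "summable f" "suminf f \<le> C"
proof -
  show s: "summable f"
    using assms by (intro summable_suminf_not_top) (auto simp: top_unique)
  show "suminf f \<le> C"
    using assms suminf_ennreal2[OF assms(1) s] by simp
qed

text \<open>A weighted \<open>\<ell>\<^sup>1\<close> sum with geometric weights is dominated by the supremum with the
  square roots of the weights, which is in turn dominated by an \<open>\<ell>\<^sup>p\<close> sum; this avoids
  distinguishing \<open>p \<ge> 1\<close> from \<open>p < 1\<close>.\<close>

lemma geometric_convolution_bound:
  fixes \<rho> p :: real
  assumes \<rho>: "0 < \<rho>" "\<rho> < 1" and p: "0 < p"
  shows "\<exists>C\<ge>0. \<forall>a. (\<forall>m. 0 \<le> a m) \<longrightarrow> summable (\<lambda>m. a m powr p) \<longrightarrow>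
           (\<forall>n. summable (\<lambda>m::nat. \<rho> ^ ((n - m) + (m - n)) * a m)) \<and>
           summable (\<lambda>n::nat. (\<Sum>m. \<rho> ^ ((n - m) + (m - n)) * a m) powr p) \<and>
           (\<Sum>n::nat. (\<Sum>m. \<rho> ^ ((n - m) + (m - n)) * a m) powr p) \<le> C * (\<Sum>m. a m powr p)"
proof -
  define \<sigma> where "\<sigma> = sqrt \<rho>"
  define \<tau> where "\<tau> = \<sigma> powr p"
  have \<sigma>: "0 < \<sigma>" "\<sigma> < 1" "\<sigma> * \<sigma> = \<rho>" using \<rho> by (auto simp: \<sigma>_def)
  have \<tau>: "0 < \<tau>" "\<tau> < 1" using \<sigma> p powr_less_mono2[of p \<sigma> 1] by (auto simp: \<tau>_def)
  define W where "W = 2 / (1 - \<sigma>)"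
  define V where "V = 2 / (1 - \<tau>)"
  have W: "0 \<le> W" and V: "0 \<le> V" using \<sigma> \<tau> by (auto simp: W_def V_def)
  let ?d = "\<lambda>n m::nat. (n - m) + (m - n)"
  have \<tau>pow: "\<tau> ^ k = (\<sigma> ^ k) powr p" for k
    using \<sigma> by (simp add: \<tau>_def powr_realpow[symmetric] powr_powr mult.commute)
  have main: "summable (\<lambda>m. \<rho> ^ ?d n m * a m) \<and> summable (\<lambda>m. \<tau> ^ ?d n m * a m powr p) \<and>
      (\<Sum>m. \<rho> ^ ?d n m * a m) powr p \<le> W powr p * (\<Sum>m. \<tau> ^ ?d n m * a m powr p)"
    if a: "\<And>m. 0 \<le> a m" and s: "summable (\<lambda>m. a m powr p)" for a :: "nat \<Rightarrow> real" and n
  proof -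
    have sS: "summable (\<lambda>m. \<tau> ^ ?d n m * a m powr p)"
      by (rule summable_comparison_test'[OF s, of 0])
        (use \<tau> in \<open>auto intro!: mult_left_le_one_le power_le_one\<close>)
    define S where "S = (\<Sum>m. \<tau> ^ ?d n m * a m powr p)"
    have S0: "0 \<le> S" unfolding S_def using \<tau> by (intro suminf_nonneg sS) auto
    have each: "\<sigma> ^ ?d n m * a m \<le> S powr (1/p)" for m
    proof -
      have "(\<Sum>i\<in>{m}. \<tau> ^ ?d n i * a i powr p) \<le> S"
        unfolding S_def using \<tau> by (intro sum_le_suminf sS) auto
      then have "(\<sigma> ^ ?d n m * a m) powr p \<le> S"
        using \<sigma> a[of m] by (simp add: \<tau>pow powr_mult)
      then have "((\<sigma> ^ ?d n m * a m) powr p) powr (1/p) \<le> S powr (1/p)"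
        using p by (intro powr_mono2) auto
      then show ?thesis using p \<sigma> a[of m] by (simp add: powr_powr)
    qed
    have le: "\<rho> ^ ?d n m * a m \<le> \<sigma> ^ ?d n m * S powr (1/p)" for m
    proof -
      have "\<rho> ^ ?d n m * a m = \<sigma> ^ ?d n m * (\<sigma> ^ ?d n m * a m)"
        by (simp add: \<sigma>(3)[symmetric] power_mult_distrib)
      also have "\<dots> \<le> \<sigma> ^ ?d n m * S powr (1/p)"
        using \<sigma> by (intro mult_left_mono each) auto
      finally show ?thesis .
    qed
    have g: "summable (\<lambda>m. \<sigma> ^ ?d n m)" "(\<Sum>m. \<sigma> ^ ?d n m) \<le> W"
      using geometric_dist_sums[OF \<sigma>(1,2)] by (auto simp: W_def)
    have sD: "summable (\<lambda>m. \<rho> ^ ?d n m * a m)"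
      by (rule summable_comparison_test'[OF summable_mult2[OF g(1), of "S powr (1/p)"], of 0])
        (use le a \<rho> in \<open>auto simp: abs_mult\<close>)
    have "(\<Sum>m. \<rho> ^ ?d n m * a m) \<le> (\<Sum>m. \<sigma> ^ ?d n m * S powr (1/p))"
      by (intro suminf_le le sD summable_mult2 g)
    also have "\<dots> = (\<Sum>m. \<sigma> ^ ?d n m) * S powr (1/p)"
      by (rule suminf_mult2[symmetric, OF g(1)])
    also have "\<dots> \<le> W * S powr (1/p)"
      using g by (intro mult_right_mono) auto
    finally have "(\<Sum>m. \<rho> ^ ?d n m * a m) powr p \<le> (W * S powr (1/p)) powr p"
      using p \<rho> a by (intro powr_mono2 suminf_nonneg sD) auto
    also have "\<dots> = W powr p * S"
      using p W S0 by (simp add: powr_mult powr_powr)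
    finally show ?thesis using sD sS by (simp add: S_def)
  qed
  define C where "C = W powr p * V"
  \<comment> \<open>The sums over n and m are swapped in \<open>ennreal\<close>, so no convergence
    of the double series has to be known beforehand.\<close>
  have total: "(\<Sum>n. ennreal ((\<Sum>m. \<rho> ^ ?d n m * a m) powr p)) \<le> ennreal (C * (\<Sum>m. a m powr p))"
    if a: "\<And>m. 0 \<le> a m" and s: "summable (\<lambda>m. a m powr p)" for a :: "nat \<Rightarrow> real"
  proof -
    have "(\<Sum>n. \<Sum>m. ennreal (\<tau> ^ ?d n m * a m powr p))
        = (\<Sum>m. \<Sum>n. ennreal (\<tau> ^ ?d n m * a m powr p))"
      by (rule suminf_ennreal_swap)
    also have "\<dots> = (\<Sum>m. ennreal (a m powr p) * (\<Sum>n. ennreal (\<tau> ^ ?d m n)))"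
    proof (intro suminf_cong)
      fix m
      have "(\<Sum>n. ennreal (\<tau> ^ ?d n m * a m powr p)) = (\<Sum>n. ennreal (a m powr p) * ennreal (\<tau> ^ ?d m n))"
        by (intro suminf_cong) (simp only: mult.commute[of _ "a m powr p"] ennreal_mult' powr_ge_zero
            add.commute[of "m - _"])
      then show "(\<Sum>n. ennreal (\<tau> ^ ?d n m * a m powr p))
          = ennreal (a m powr p) * (\<Sum>n. ennreal (\<tau> ^ ?d m n))"
        by (simp only: ennreal_suminf_cmult)
    qed
    also have "\<dots> \<le> (\<Sum>m. ennreal (a m powr p) * ennreal V)"
      using geometric_dist_sums[OF \<tau>] \<tau>
      by (intro suminf_le mult_left_mono) (auto simp: suminf_ennreal2 V_def intro!: ennreal_leI)
    also have "\<dots> = ennreal V * ennreal (\<Sum>m. a m powr p)"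
      using s by (simp add: mult.commute[of _ "ennreal V"] ennreal_suminf_cmult suminf_ennreal2)
    finally have inner: "(\<Sum>n. \<Sum>m. ennreal (\<tau> ^ ?d n m * a m powr p)) \<le> ennreal V * ennreal (\<Sum>m. a m powr p)" .
    have "(\<Sum>n. ennreal ((\<Sum>m. \<rho> ^ ?d n m * a m) powr p))
        \<le> (\<Sum>n. ennreal (W powr p * (\<Sum>m. \<tau> ^ ?d n m * a m powr p)))"
      using main[OF a s] by (intro suminf_le ennreal_leI) auto
    also have "\<dots> = (\<Sum>n. ennreal (W powr p) * (\<Sum>m. ennreal (\<tau> ^ ?d n m * a m powr p)))"
    proof (intro suminf_cong)
      fix n
      have "(\<Sum>m. ennreal (\<tau> ^ ?d n m * a m powr p)) = ennreal (\<Sum>m. \<tau> ^ ?d n m * a m powr p)"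
        using main[OF a s] \<tau> by (intro suminf_ennreal2) auto
      then show "ennreal (W powr p * (\<Sum>m. \<tau> ^ ?d n m * a m powr p))
          = ennreal (W powr p) * (\<Sum>m. ennreal (\<tau> ^ ?d n m * a m powr p))"
        by (simp only: ennreal_mult' powr_ge_zero)
    qed
    also have "\<dots> = ennreal (W powr p) * (\<Sum>n. \<Sum>m. ennreal (\<tau> ^ ?d n m * a m powr p))"
      by (rule ennreal_suminf_cmult)
    also have "\<dots> \<le> ennreal (W powr p) * (ennreal V * ennreal (\<Sum>m. a m powr p))"
      by (intro mult_left_mono inner) simp
    also have "\<dots> = ennreal (C * (\<Sum>m. a m powr p))"
      using V by (simp only: C_def ennreal_mult' powr_ge_zero mult.assoc)
    finally show ?thesis .
  qed
  show ?thesis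
  proof (intro exI[of _ C] conjI allI impI)
    show C: "0 \<le> C" using V by (simp add: C_def)
    fix a :: "nat \<Rightarrow> real" assume "\<forall>m. 0 \<le> a m" and s: "summable (\<lambda>m. a m powr p)"
    then have a: "\<And>m. 0 \<le> a m" by blast
    show "summable (\<lambda>m. \<rho> ^ ?d n m * a m)" for n using main[OF a s] by blast
    have "0 \<le> C * (\<Sum>m. a m powr p)" using C s by (intro mult_nonneg_nonneg suminf_nonneg) auto
    note * = summable_le_suminf_ennreal[OF _ total[OF a s] this]
    show "summable (\<lambda>n. (\<Sum>m. \<rho> ^ ?d n m * a m) powr p)" by (rule *(1)) auto
    show "(\<Sum>n. (\<Sum>m. \<rho> ^ ?d n m * a m) powr p) \<le> C * (\<Sum>m. a m powr p)" by (rule *(2)) auto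
  qed
qed

section \<open>Circle means of the derivative\<close>

text \<open>From 2xy \<le> x^2 + y^2 the terms are dominated by |\<alpha>(n)|^2 + |z|^(2n), and both
  of these series converge.\<close>

lemma l2_power_series_summable:
  assumes "is_l2 \<alpha>" "cmod z < 1"
  shows "summable (\<lambda>n. \<alpha> n * z ^ n)"
proof (rule summable_comparison_test')
  show "summable (\<lambda>n. (cmod (\<alpha> n))\<^sup>2 + ((cmod z)\<^sup>2) ^ n)"
    using assms by (intro summable_add summable_geometric) (auto simp: is_l2_def abs_square_less_1)
  show "norm (\<alpha> n * z ^ n) \<le> (cmod (\<alpha> n))\<^sup>2 + ((cmod z)\<^sup>2) ^ n" if "0 \<le> n" for n
  proof -
    have "2 * (cmod (\<alpha> n) * cmod z ^ n) \<le> (cmod (\<alpha> n))\<^sup>2 + (cmod z ^ n)\<^sup>2"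
      using sum_squares_bound[of "cmod (\<alpha> n)" "cmod z ^ n"] by simp
    moreover have "0 \<le> cmod (\<alpha> n) * cmod z ^ n" by simp
    moreover have "(cmod z ^ n)\<^sup>2 = ((cmod z)\<^sup>2) ^ n" by (simp add: mult.commute flip: power_mult)
    ultimately show ?thesis by (simp only: norm_mult norm_power)
  qed
qed

lemma l2_power_series_deriv:
  assumes "is_l2 \<alpha>" "cmod z < 1"
  shows "((\<lambda>z. \<Sum>n. \<alpha> n * z ^ n) has_field_derivative (\<Sum>n. diffs \<alpha> n * z ^ n)) (at z)"
proof -
  obtain x where x: "cmod z < x" "x < 1" using assms(2) dense by blast
  then have "0 \<le> x" by (smt (verit) norm_ge_zero)
  then show ?thesis
    using x assms by (intro termdiffs_strong[where K = "of_real x"] l2_power_series_summable) auto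
qed

lemma l2_power_series_diffs_summable:
  assumes "is_l2 \<alpha>" "cmod z < 1"
  shows "summable (\<lambda>n. cmod (diffs \<alpha> n * z ^ n))"
proof -
  obtain x where x: "cmod z < x" "x < 1" using assms(2) dense by blast
  then have x0: "0 \<le> x" by (smt (verit) norm_ge_zero)
  have "summable (\<lambda>n. diffs \<alpha> n * of_real x ^ n)"
    using x x0 assms by (intro termdiff_converges[where K = 1] l2_power_series_summable) auto
  from powser_insidea[OF this, of z] show ?thesis using x x0 by auto
qed

lemma has_integral_cis_int:
  fixes k :: int
  shows "((\<lambda>\<theta>. cis (of_int k * \<theta>)) has_integral (if k = 0 then 2 * pi else 0)) {0..2 * pi}"
proof (cases "k = 0")
  case True
  then show ?thesis
    using has_integral_const_real[of "1 :: complex" 0 "2 * pi"] by (simp add: scaleR_conv_of_real)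
next
  case False
  let ?F = "\<lambda>z. exp (\<i> * of_int k * z) / (\<i> * of_int k)"
  have "((\<lambda>\<theta>. exp (\<i> * of_int k * of_real \<theta>)) has_integral
      (?F (of_real (2 * pi)) - ?F (of_real 0))) {0..2 * pi}"
  proof (rule fundamental_theorem_of_calculus)
    show "((\<lambda>\<theta>. ?F (of_real \<theta>)) has_vector_derivative exp (\<i> * of_int k * of_real \<theta>))
        (at \<theta> within {0..2 * pi})" for \<theta>
      by (rule has_vector_derivative_real_field)
        (use False in \<open>auto intro!: derivative_eq_intros\<close>)
  qed simp
  moreover have "exp (\<i> * of_int k * of_real (2 * pi)) = 1"
    by (subst exp_eq_1) (auto intro!: exI[of _ k])
  moreover have "(\<lambda>\<theta>. exp (\<i> * of_int k * of_real \<theta>)) = (\<lambda>\<theta>. cis (of_int k * \<theta>))"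
    by (auto simp: cis_conv_exp mult.assoc)
  ultimately show ?thesis using False by simp
qed

text \<open>Expanding the square as a double sum over n and m leaves integrals of the characters
  with frequency n - m, of which only those with n = m survive.\<close>

lemma has_integral_norm_trig_poly:
  fixes b :: "nat \<Rightarrow> complex"
  shows "((\<lambda>\<theta>. (cmod (\<Sum>n<N. b n * cis \<theta> ^ n))\<^sup>2) has_integral
            (2 * pi * (\<Sum>n<N. (cmod (b n))\<^sup>2))) {0..2 * pi}"
proof -
  have eq: "complex_of_real ((cmod (\<Sum>n<N. b n * cis \<theta> ^ n))\<^sup>2)
      = (\<Sum>n<N. \<Sum>m<N. b n * cnj (b m) * cis (of_int (int n - int m) * \<theta>))" for \<theta>
    unfolding complex_norm_square cnj_sum sum_product
    by (intro sum.cong refl) (simp add: Complex.DeMoivre cis_cnj left_diff_distrib cis_mult)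
  have "((\<lambda>\<theta>. \<Sum>n<N. \<Sum>m<N. b n * cnj (b m) * cis (of_int (int n - int m) * \<theta>)) has_integral
      (\<Sum>n<N. \<Sum>m<N. b n * cnj (b m) * (if int n - int m = 0 then 2 * pi else 0))) {0..2 * pi}"
    by (intro has_integral_sum finite_lessThan has_integral_mult_right has_integral_cis_int)
  also have "(\<Sum>n<N. \<Sum>m<N. b n * cnj (b m) * (if int n - int m = 0 then 2 * pi else 0))
      = (\<Sum>n<N. \<Sum>m<N. if m = n then b n * cnj (b n) * (2 * pi) else 0)"
    by (intro sum.cong refl) auto
  also have "\<dots> = (\<Sum>n<N. b n * cnj (b n) * (2 * pi))"
    by (intro sum.cong refl) (simp add: sum.delta')
  also have "\<dots> = complex_of_real (2 * pi * (\<Sum>n<N. (cmod (b n))\<^sup>2))"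
    by (simp add: complex_norm_square[symmetric] sum_distrib_left mult.commute del: of_real_power)
  finally have "((\<lambda>\<theta>. complex_of_real ((cmod (\<Sum>n<N. b n * cis \<theta> ^ n))\<^sup>2)) has_integral
      complex_of_real (2 * pi * (\<Sum>n<N. (cmod (b n))\<^sup>2))) {0..2 * pi}"
    by (simp only: eq)
  from has_integral_linear[OF this bounded_linear_Re] show ?thesis
    by (simp only: o_def Re_complex_of_real)
qed

text \<open>Absolute summability bounds all partial sums on the circle by S, so the identity for
  trigonometric polynomials passes to the limit by dominated convergence with the constant
  S^2.\<close>

lemma parseval_absolutely_summable:
  fixes b :: "nat \<Rightarrow> complex"
  assumes b: "summable (\<lambda>n. cmod (b n))"
  shows "summable (\<lambda>n. (cmod (b n))\<^sup>2)"
    and "integral {0..2 * pi} (\<lambda>\<theta>. (cmod (\<Sum>n. b n * cis \<theta> ^ n))\<^sup>2) = 2 * pi * (\<Sum>n. (cmod (b n))\<^sup>2)"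
proof -
  define S where "S = (\<Sum>n. cmod (b n))"
  have bS: "cmod (b n) \<le> S" for n
    using sum_le_suminf[OF b, of "{n}"] by (simp add: S_def)
  show s2: "summable (\<lambda>n. (cmod (b n))\<^sup>2)"
    by (rule summable_comparison_test'[OF summable_mult[OF b, of S], of 0])
      (use bS in \<open>auto simp: power2_eq_square intro!: mult_right_mono\<close>)
  let ?g = "\<lambda>N \<theta>. (cmod (\<Sum>n<N. b n * cis \<theta> ^ n))\<^sup>2"
  let ?h = "\<lambda>\<theta>. (cmod (\<Sum>n. b n * cis \<theta> ^ n))\<^sup>2"
  have "(\<lambda>N. integral {0..2 * pi} (?g N)) \<longlonglongrightarrow> integral {0..2 * pi} ?h"
  proof (rule dominated_convergence(2))
    show "?g N integrable_on {0..2 * pi}" for N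
      using has_integral_norm_trig_poly by (rule has_integral_integrable)
    show "(\<lambda>\<theta>. S\<^sup>2) integrable_on {0..2 * pi}" by (rule integrable_const_ivl)
    show "norm (?g N \<theta>) \<le> S\<^sup>2" for N \<theta>
    proof -
      have "cmod (\<Sum>n<N. b n * cis \<theta> ^ n) \<le> (\<Sum>n<N. cmod (b n))"
        by (rule sum_norm_le) (simp add: norm_mult norm_power)
      also have "\<dots> \<le> S" unfolding S_def by (intro sum_le_suminf b) auto
      finally show ?thesis by (simp add: power_mono)
    qed
    show "(\<lambda>N. ?g N \<theta>) \<longlonglongrightarrow> ?h \<theta>" for \<theta>
    proof -
      have "summable (\<lambda>n. b n * cis \<theta> ^ n)"
        by (rule summable_norm_cancel) (use b in \<open>simp add: norm_mult norm_power\<close>)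
      then show ?thesis by (intro tendsto_intros summable_LIMSEQ)
    qed
  qed
  moreover have "integral {0..2 * pi} (?g N) = 2 * pi * (\<Sum>n<N. (cmod (b n))\<^sup>2)" for N
    using has_integral_norm_trig_poly by (rule integral_unique)
  moreover have "(\<lambda>N. 2 * pi * (\<Sum>n<N. (cmod (b n))\<^sup>2)) \<longlonglongrightarrow> 2 * pi * (\<Sum>n. (cmod (b n))\<^sup>2)"
    by (intro tendsto_intros summable_LIMSEQ s2)
  ultimately show "integral {0..2 * pi} ?h = 2 * pi * (\<Sum>n. (cmod (b n))\<^sup>2)"
    by (simp only: LIMSEQ_unique)
qed

text \<open>Parseval is applied to the derivative on the circle of radius r, with coefficients
  \<open>diffs \<alpha> n * r ^ n\<close>; the shift to \<open>Suc n\<close> comes from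
  differentiation.\<close>

lemma circle_mean_deriv:
  assumes \<alpha>: "is_l2 \<alpha>" and r: "0 < r" "r < 1"
  defines "h \<equiv> \<lambda>n. (real (Suc n))\<^sup>2 * (cmod (\<alpha> (Suc n)))\<^sup>2 * r ^ (2 * n)"
  shows "summable h"
    and "integral {0..2 * pi} (\<lambda>\<theta>. (cmod (deriv (\<lambda>z. \<Sum>n. \<alpha> n * z ^ n) (complex_of_real r * cis \<theta>)))\<^sup>2)
           = 2 * pi * suminf h"
proof -
  let ?b = "\<lambda>n. diffs \<alpha> n * of_real r ^ n"
  have b: "summable (\<lambda>n. cmod (?b n))"
    by (rule l2_power_series_diffs_summable[OF \<alpha>]) (use r in auto)
  have h: "h = (\<lambda>n. (cmod (?b n))\<^sup>2)"
  proof
    fix n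
    have "cmod (?b n) = real (Suc n) * cmod (\<alpha> (Suc n)) * r ^ n"
      using r by (simp add: diffs_def norm_mult norm_power del: of_nat_Suc)
    then show "h n = (cmod (?b n))\<^sup>2"
      by (simp only: h_def power_mult_distrib power_even_eq)
  qed
  have d: "deriv (\<lambda>z. \<Sum>n. \<alpha> n * z ^ n) (complex_of_real r * cis \<theta>) = (\<Sum>n. ?b n * cis \<theta> ^ n)" for \<theta>
    using DERIV_imp_deriv[OF l2_power_series_deriv[OF \<alpha>, of "of_real r * cis \<theta>"]] r
    by (simp add: norm_mult power_mult_distrib mult.assoc)
  show "summable h" "integral {0..2 * pi} (\<lambda>\<theta>. (cmod (deriv (\<lambda>z. \<Sum>n. \<alpha> n * z ^ n)
      (complex_of_real r * cis \<theta>)))\<^sup>2) = 2 * pi * suminf h"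
    unfolding h d using parseval_absolutely_summable[OF b] by auto
qed

section \<open>Comparison of the circle means with the block energies s(n)^2\<close>

definition dyadic_energy :: "(nat \<Rightarrow> complex) \<Rightarrow> nat \<Rightarrow> real" where
  "dyadic_energy \<alpha> n = 2 ^ n * (\<Sum>j\<in>{2 ^ n..<2 ^ (n + 1)}. (cmod (\<alpha> j))\<^sup>2)"

lemma dyadic_energy_nonneg [simp]: "0 \<le> dyadic_energy \<alpha> n"
  by (simp add: dyadic_energy_def sum_nonneg)

text \<open>For 1 - r \<le> 2^(-n) the powers of r attached to block n are bounded below, so this
  block alone contributes a fixed fraction of 4^n times its sum of squares.\<close>

lemma derivative_mean_ge_dyadic_energy:
  assumes n: "1 \<le> n" and r: "1 - (1/2) ^ n \<le> r" "r < 1"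
    and s: "summable (\<lambda>n. (real (Suc n))\<^sup>2 * (cmod (\<alpha> (Suc n)))\<^sup>2 * r ^ (2 * n))"
  shows "2 ^ n * dyadic_energy \<alpha> n / 256
           \<le> (\<Sum>n. (real (Suc n))\<^sup>2 * (cmod (\<alpha> (Suc n)))\<^sup>2 * r ^ (2 * n))"
proof -
  define g where "g = (\<lambda>j. (real j)\<^sup>2 * (cmod (\<alpha> j))\<^sup>2 * r ^ (2 * (j - 1)))"
  obtain k where k: "n = Suc k" using n by (cases n) auto
  have r0: "0 \<le> r"
    using r power_le_one[of "1/2::real" n] by simp
  \<comment> \<open>Bernoulli with exponent 2^(n-1) gives 1/2; the indices in block n carry
    exponents of at most 8 * 2^(n-1), hence the eighth power and the constant 256.\<close>
  have "1/2 \<le> 1 + real (2 ^ k) * (- ((1/2) ^ n))"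
    by (simp add: k power_divide)
  also have "\<dots> \<le> (1 + (- ((1/2) ^ n))) ^ (2 ^ k)"
    using power_le_one[of "1/2::real" n] by (intro Bernoulli_inequality) simp
  also have "\<dots> \<le> r ^ (2 ^ k)"
    using r power_le_one[of "1/2::real" n] by (intro power_mono) auto
  finally have "(1/2) ^ 8 \<le> (r ^ (2 ^ k)) ^ 8" by (intro power_mono) auto
  then have rp: "1/256 \<le> r ^ (8 * 2 ^ k)"
    by (simp add: mult.commute power_divide flip: power_mult)
  have "2 ^ n * dyadic_energy \<alpha> n / 256
      = (\<Sum>j\<in>{2 ^ n..<2 ^ (n + 1)}. (2 ^ n)\<^sup>2 * (cmod (\<alpha> j))\<^sup>2 * (1/256))"
    by (simp add: dyadic_energy_def power2_eq_square sum_distrib_left sum_divide_distrib mult.assoc)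
  also have "\<dots> \<le> sum g {2 ^ n..<2 ^ (n + 1)}"
    unfolding g_def
  proof (intro sum_mono mult_mono)
    fix j :: nat assume j: "j \<in> {2 ^ n..<2 ^ (n + 1)}"
    then have "real (2 ^ n) \<le> real j" unfolding of_nat_le_iff by simp
    then show "(2 ^ n)\<^sup>2 \<le> (real j)\<^sup>2" by (simp add: power_mono)
    have "j < 4 * 2 ^ k" using j k by simp
    then have "2 * (j - 1) \<le> 8 * 2 ^ k" by linarith
    then have "r ^ (8 * 2 ^ k) \<le> r ^ (2 * (j - 1))" using r0 r by (intro power_decreasing) auto
    then show "1/256 \<le> r ^ (2 * (j - 1))" using rp by linarith
  qed auto
  also have "\<dots> = sum (g \<circ> Suc) {2 ^ n - 1..<2 ^ (n + 1) - 1}"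
  proof -
    have "{2 ^ n..<2 ^ (n + 1)} = {Suc (2 ^ n - 1)..<Suc (2 ^ (n + 1) - 1)}" by simp
    then show ?thesis by (simp only: sum.atLeast_Suc_lessThan_Suc_shift)
  qed
  also have "\<dots> \<le> suminf (g \<circ> Suc)"
    using s r0 by (intro sum_le_suminf) (auto simp: g_def o_def)
  finally show ?thesis by (simp add: g_def o_def)
qed

text \<open>The power is compared with exp(-x), where x = 2^(m-n). For m \<le> n the exponential is
  bounded by 1; for m > n its decay beats the growth of 2^m. This produces the two-sided geometric
  kernel in |n - m|.\<close>

lemma dyadic_weight_decay:
  fixes r :: real
  assumes r: "0 < r" "r < 1 - (1/2) ^ (n + 1)"
  shows "2 ^ m * r ^ (2 * (2 ^ m - 1)) \<le> 8 * 2 ^ n * (1/2) ^ ((n - m) + (m - n))"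
proof -
  define \<rho> :: real where "\<rho> = 1 - (1/2) ^ (n + 1)"
  define x :: real where "x = 2 ^ m / 2 ^ n"
  have \<rho>: "1/2 \<le> \<rho>" "\<rho> \<le> 1"
    using power_decreasing[of 1 "n + 1" "1/2::real"] by (auto simp: \<rho>_def)
  have "r ^ (2 * (2 ^ m - 1)) \<le> \<rho> ^ (2 * (2 ^ m - 1))"
    using r by (intro power_mono) (auto simp: \<rho>_def)
  \<comment> \<open>Completing the exponent 2(2^m - 1) to 2 * 2^m costs \<rho>^(-2), which is at
    most 4 because \<rho> \<ge> 1/2.\<close>
  also have "\<dots> \<le> 4 * (\<rho>\<^sup>2 * \<rho> ^ (2 * (2 ^ m - 1)))"
  proof -
    have "(1/2)\<^sup>2 \<le> \<rho>\<^sup>2" using \<rho> by (intro power_mono) auto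
    then have "1 * \<rho> ^ (2 * (2 ^ m - 1)) \<le> (4 * \<rho>\<^sup>2) * \<rho> ^ (2 * (2 ^ m - 1))"
      using \<rho> by (intro mult_right_mono) (auto simp: power_divide)
    then show ?thesis by simp
  qed
  also have "\<rho>\<^sup>2 * \<rho> ^ (2 * (2 ^ m - 1)) = \<rho> ^ (2 * 2 ^ m)"
  proof -
    have "(1::nat) \<le> 2 ^ m" by simp
    then have "2 + 2 * (2 ^ m - 1) = (2 * 2 ^ m :: nat)" by linarith
    then show ?thesis unfolding power_add[symmetric] by simp
  qed
  also have "\<rho> ^ (2 * 2 ^ m) \<le> exp (- x)"
  proof -
    have "\<rho> \<le> exp (- ((1/2) ^ (n + 1)))"
      using exp_ge_add_one_self[of "- ((1/2::real) ^ (n + 1))"] by (simp add: \<rho>_def)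
    then have "\<rho> ^ (2 * 2 ^ m) \<le> exp (- ((1/2) ^ (n + 1))) ^ (2 * 2 ^ m)"
      using \<rho> by (intro power_mono) auto
    also have "\<dots> = exp (- x)"
      by (simp add: x_def power_divide flip: exp_of_nat_mult)
    finally show ?thesis .
  qed
  finally have rx: "r ^ (2 * (2 ^ m - 1)) \<le> 4 * exp (- x)" by simp
  have "2 ^ m * exp (- x) \<le> 2 * 2 ^ n * (1/2) ^ ((n - m) + (m - n))"
  proof (cases "m \<le> n")
    case True
    then have "2 ^ n * (1/2) ^ (n - m) = (2 ^ m :: real)"
      by (simp add: power_diff power_divide)
    moreover have "2 ^ m * exp (- x) \<le> 2 ^ m * 1"
      by (intro mult_left_mono) (auto simp: x_def)
    moreover have "(n - m) + (m - n) = n - m" using True by simp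
    moreover have "0 < (2::real) ^ m" by simp
    ultimately show ?thesis by (simp only: mult.assoc)
  next
    case False
    then have w: "(1/2) ^ ((n - m) + (m - n)) = 1 / x" by (simp add: x_def power_diff power_divide)
    \<comment> \<open>The bound exp x \<ge> x^2/2 gives x exp(-x) \<le> 2/x, and 1/x is exactly the
      kernel value for m > n.\<close>
    have x: "0 < x" by (simp add: x_def)
    have "x\<^sup>2 \<le> 2 * exp x" using exp_lower_Taylor_quadratic[of x] x by simp
    then have "x * exp (- x) \<le> 2 / x"
      using x by (simp add: exp_minus field_simps power2_eq_square)
    then have "2 ^ n * (x * exp (- x)) \<le> 2 ^ n * (2 / x)"
      by (intro mult_left_mono) auto
    moreover have "2 ^ n * x = 2 ^ m" by (simp add: x_def)
    ultimately show ?thesis unfolding w by (simp add: mult.assoc[symmetric] mult.commute[of 2])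
  qed
  moreover have "2 ^ m * r ^ (2 * (2 ^ m - 1)) \<le> 2 ^ m * (4 * exp (- x))"
    by (intro mult_left_mono rx) auto
  ultimately show ?thesis by linarith
qed

text \<open>In block m one has j < 2^(m+1), so j^2 is at most 4 * 4^m: one factor 2^m completes the
  block energy, the other is damped by \<open>dyadic_weight_decay\<close>. The constants 4 and 8
  multiply to 32.\<close>

lemma derivative_mean_le_dyadic_energy:
  assumes r: "0 < r" "r < 1 - (1/2) ^ (n + 1)"
    and s: "summable (\<lambda>n. (real (Suc n))\<^sup>2 * (cmod (\<alpha> (Suc n)))\<^sup>2 * r ^ (2 * n))"
    and sE: "summable (\<lambda>m. (1/2) ^ ((n - m) + (m - n)) * dyadic_energy \<alpha> m)"
  shows "(\<Sum>n. (real (Suc n))\<^sup>2 * (cmod (\<alpha> (Suc n)))\<^sup>2 * r ^ (2 * n))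
           \<le> 32 * 2 ^ n * (\<Sum>m. (1/2) ^ ((n - m) + (m - n)) * dyadic_energy \<alpha> m)"
proof (rule suminf_le_const[OF s])
  fix N
  define g where "g = (\<lambda>j. (real j)\<^sup>2 * (cmod (\<alpha> j))\<^sup>2 * r ^ (2 * (j - 1)))"
  have g0: "0 \<le> g j" for j using r by (simp add: g_def)
  have r1: "r < 1" using r zero_less_power[of "1/2::real" "n+1"] by linarith
  have block: "sum g {2 ^ m..<2 ^ (m + 1)} \<le> 32 * 2 ^ n * ((1/2) ^ ((n - m) + (m - n)) * dyadic_energy \<alpha> m)" for m
  proof -
    have "sum g {2 ^ m..<2 ^ (m + 1)}
        \<le> (\<Sum>j\<in>{2 ^ m..<2 ^ (m + 1)}. (2 ^ (m + 1))\<^sup>2 * (cmod (\<alpha> j))\<^sup>2 * r ^ (2 * (2 ^ m - 1)))"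
      unfolding g_def
    proof (intro sum_mono mult_mono)
      fix j :: nat assume j: "j \<in> {2 ^ m..<2 ^ (m + 1)}"
      then have "real j \<le> real (2 ^ (m + 1))" unfolding of_nat_le_iff by simp
      then have "(real j)\<^sup>2 \<le> (real (2 ^ (m + 1)))\<^sup>2" by (intro power_mono) auto
      then show "(real j)\<^sup>2 \<le> (2 ^ (m + 1))\<^sup>2" by simp
      show "r ^ (2 * (j - 1)) \<le> r ^ (2 * (2 ^ m - 1))"
        using j r r1 by (intro power_decreasing) auto
    qed (use r in auto)
    also have "\<dots> = 4 * dyadic_energy \<alpha> m * (2 ^ m * r ^ (2 * (2 ^ m - 1)))"
      by (simp add: dyadic_energy_def power2_eq_square sum_distrib_left sum_distrib_right mult_ac)
    also have "\<dots> \<le> 4 * dyadic_energy \<alpha> m * (8 * 2 ^ n * (1/2) ^ ((n - m) + (m - n)))"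
      by (intro mult_left_mono dyadic_weight_decay r) auto
    finally show ?thesis by (simp add: mult_ac)
  qed
  have "(\<Sum>i<N. (real (Suc i))\<^sup>2 * (cmod (\<alpha> (Suc i)))\<^sup>2 * r ^ (2 * i)) = sum (g \<circ> Suc) {0..<N}"
    by (simp add: g_def o_def lessThan_atLeast0)
  also have "\<dots> = sum g {Suc 0..<Suc N}" by (rule sum.atLeast_Suc_lessThan_Suc_shift[symmetric])
  also have "\<dots> \<le> sum g {1..<2 ^ Suc N}"
    using g0 less_exp[of "Suc N"] by (intro sum_mono2) auto
  also have "\<dots> = (\<Sum>m<Suc N. sum g {2 ^ m..<2 ^ (m + 1)})" by (rule sum_dyadic_blocks)
  also have "\<dots> \<le> (\<Sum>m<Suc N. 32 * 2 ^ n * ((1/2) ^ ((n - m) + (m - n)) * dyadic_energy \<alpha> m))"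
    by (intro sum_mono block)
  also have "\<dots> = 32 * 2 ^ n * (\<Sum>m<Suc N. (1/2) ^ ((n - m) + (m - n)) * dyadic_energy \<alpha> m)"
    by (rule sum_distrib_left[symmetric])
  also have "\<dots> \<le> 32 * 2 ^ n * (\<Sum>m. (1/2) ^ ((n - m) + (m - n)) * dyadic_energy \<alpha> m)"
    by (intro mult_left_mono sum_le_suminf sE) auto
  finally show "(\<Sum>i<N. (real (Suc i))\<^sup>2 * (cmod (\<alpha> (Suc i)))\<^sup>2 * r ^ (2 * i))
      \<le> 32 * 2 ^ n * (\<Sum>m. (1/2) ^ ((n - m) + (m - n)) * dyadic_energy \<alpha> m)" .
qed

section \<open>Reduction of radial integrals to series over dyadic annuli\<close>

definition dyadic_annulus :: "nat \<Rightarrow> real set" where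
  "dyadic_annulus n = {1 - (1/2) ^ n..<1 - (1/2) ^ (n + 1)}"

lemma dyadic_annulus_cover:
  assumes "0 \<le> r" "r < 1"
  obtains n where "r \<in> dyadic_annulus n"
proof -
  have ex: "\<exists>n. r < 1 - (1/2) ^ (n + 1)"
  proof -
    obtain n where n: "(1/2) ^ n < 1 - r" using real_arch_pow_inv[of "1 - r" "1/2"] assms by auto
    have "(1/2) ^ (n + 1) \<le> (1/2::real) ^ n" by (rule power_decreasing) auto
    then show ?thesis using n by (intro exI[of _ n]) linarith
  qed
  define n where "n = (LEAST n. r < 1 - (1/2) ^ (n + 1))"
  have 1: "r < 1 - (1/2) ^ (n + 1)" unfolding n_def by (rule LeastI_ex[OF ex])
  have "1 - (1/2) ^ n \<le> r"
  proof (cases n)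
    case 0
    then show ?thesis using assms by simp
  next
    case (Suc k)
    then have "\<not> r < 1 - (1/2) ^ (k + 1)"
      using not_less_Least[of k "\<lambda>n. r < 1 - (1/2) ^ (n + 1)"] unfolding n_def[symmetric] by auto
    then show ?thesis using Suc by simp
  qed
  with 1 show ?thesis by (intro that[of n]) (simp add: dyadic_annulus_def)
qed

lemma dyadic_annulus_disjoint:
  assumes "r \<in> dyadic_annulus n" "r \<in> dyadic_annulus m"
  shows "n = m"
proof -
  have "\<not> n < m" if "r \<in> dyadic_annulus n" "r \<in> dyadic_annulus m" for n m
  proof
    assume "n < m"
    then have "(1/2) ^ m \<le> (1/2 :: real) ^ (n + 1)" by (intro power_decreasing) auto
    then show False using that by (auto simp: dyadic_annulus_def)
  qed
  then show ?thesis using assms by (metis linorder_neqE_nat)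
qed

text \<open>The annulus with index n has length 2^(-n-1), so the height 2^n b(n) contributes b(n)/2.
  Step functions normalised in this way turn the Besov integral into a series.\<close>

lemma nn_integral_dyadic_annuli:
  assumes b: "\<And>n. 0 \<le> b n"
  shows "(\<integral>\<^sup>+ r. (\<Sum>n. indicator (dyadic_annulus n) r * ennreal (2 ^ n * b n)) \<partial>lborel)
           = (\<Sum>n. ennreal (b n / 2))"
proof -
  have m: "dyadic_annulus n \<in> sets lborel" for n by (simp add: dyadic_annulus_def)
  have "(\<integral>\<^sup>+ r. (\<Sum>n. indicator (dyadic_annulus n) r * ennreal (2 ^ n * b n)) \<partial>lborel)
      = (\<Sum>n. \<integral>\<^sup>+ r. indicator (dyadic_annulus n) r * ennreal (2 ^ n * b n) \<partial>lborel)"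
    by (rule nn_integral_suminf) (use m in measurable)
  also have "\<dots> = (\<Sum>n. ennreal (b n / 2))"
  proof (rule suminf_cong)
    fix n
    have "(1/2 :: real) ^ (n + 1) \<le> (1/2) ^ n" by (rule power_decreasing) auto
    then have "emeasure lborel (dyadic_annulus n) = ennreal ((1/2) ^ (n + 1))"
      by (simp add: dyadic_annulus_def)
    then have "(\<integral>\<^sup>+ r. indicator (dyadic_annulus n) r * ennreal (2 ^ n * b n) \<partial>lborel)
        = ennreal ((1/2) ^ (n + 1)) * ennreal (2 ^ n * b n)"
      using m by (simp add: nn_integral_multc)
    also have "\<dots> = ennreal (b n / 2)"
      by (subst ennreal_mult'[symmetric]) (auto simp: power_divide)
    finally show "(\<integral>\<^sup>+ r. indicator (dyadic_annulus n) r * ennreal (2 ^ n * b n) \<partial>lborel)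
        = ennreal (b n / 2)" .
  qed
  finally show ?thesis .
qed

lemma nn_integral_unit_le_dyadic:
  assumes b: "\<And>n. 0 \<le> b n"
    and le: "\<And>n r. r \<in> dyadic_annulus n \<Longrightarrow> 0 < r \<Longrightarrow> \<phi> r \<le> 2 ^ n * b n"
  shows "(\<integral>\<^sup>+ r. indicator {0<..<1} r * ennreal (\<phi> r) \<partial>lborel) \<le> (\<Sum>n. ennreal (b n / 2))"
  unfolding nn_integral_dyadic_annuli[OF b, symmetric]
proof (rule nn_integral_mono)
  fix r :: real
  show "indicator {0<..<1} r * ennreal (\<phi> r)
      \<le> (\<Sum>n. indicator (dyadic_annulus n) r * ennreal (2 ^ n * b n))"
  proof (cases "0 < r \<and> r < 1")
    case True
    then obtain n where n: "r \<in> dyadic_annulus n" using dyadic_annulus_cover[of r] by auto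
    have "indicator {0<..<1} r * ennreal (\<phi> r)
        \<le> (\<Sum>i\<in>{n}. indicator (dyadic_annulus i) r * ennreal (2 ^ i * b i))"
      using True n le[OF n] by (simp add: ennreal_leI)
    also have "\<dots> \<le> (\<Sum>n. indicator (dyadic_annulus n) r * ennreal (2 ^ n * b n))"
      by (rule sum_le_suminf) auto
    finally show ?thesis .
  qed (auto simp: indicator_def)
qed

text \<open>The term with index 0 is dropped: the lower estimate of the circle means starts at n =
  1, and from there on the annuli lie inside the open unit interval.\<close>

lemma nn_integral_unit_ge_dyadic:
  assumes b: "\<And>n. 0 \<le> b n" and b0: "b 0 = 0"
    and ge: "\<And>n r. 1 \<le> n \<Longrightarrow> r \<in> dyadic_annulus n \<Longrightarrow> 2 ^ n * b n \<le> \<phi> r"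
  shows "(\<Sum>n. ennreal (b n / 2)) \<le> (\<integral>\<^sup>+ r. indicator {0<..<1} r * ennreal (\<phi> r) \<partial>lborel)"
  unfolding nn_integral_dyadic_annuli[OF b, symmetric]
proof (rule nn_integral_mono)
  fix r :: real
  show "(\<Sum>n. indicator (dyadic_annulus n) r * ennreal (2 ^ n * b n))
      \<le> indicator {0<..<1} r * ennreal (\<phi> r)"
  proof (cases "\<exists>n. r \<in> dyadic_annulus n")
    case True
    then obtain n where n: "r \<in> dyadic_annulus n" by blast
    have "(\<Sum>n. indicator (dyadic_annulus n) r * ennreal (2 ^ n * b n))
        = (\<Sum>i\<in>{n}. indicator (dyadic_annulus i) r * ennreal (2 ^ i * b i))"
      by (rule suminf_finite) (use n dyadic_annulus_disjoint in \<open>auto simp: indicator_def\<close>)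
    also have "\<dots> \<le> indicator {0<..<1} r * ennreal (\<phi> r)"
    proof (cases "n = 0")
      case True
      then show ?thesis by (simp add: b0)
    next
      case False
      have "(1/2 :: real) ^ n < 1" "0 < (1/2 :: real) ^ (n + 1)" using False by (auto simp: power_less_one_iff)
      then have "0 < r" "r < 1" using n by (auto simp: dyadic_annulus_def)
      then show ?thesis using ge[OF _ n] False n by (simp add: ennreal_leI)
    qed
    finally show ?thesis .
  qed (auto simp: indicator_def)
qed

text \<open>The exponent will be p - 1, whose sign is not fixed; a power is monotone on [1/2, 1] in
  either case, so its extreme values are taken at the endpoints.\<close>

lemma powr_half_bounds:
  fixes u s :: real
  assumes "1/2 \<le> u" "u \<le> 1"
  shows "u powr s \<le> max 1 ((1/2) powr s)" "min 1 ((1/2) powr s) \<le> u powr s"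
proof -
  have "u powr s \<le> max 1 ((1/2) powr s) \<and> min 1 ((1/2) powr s) \<le> u powr s"
  proof (cases "0 \<le> s")
    case True
    then show ?thesis
      using powr_mono2[of s "1/2" u] powr_mono2[of s u 1] assms by auto
  next
    case False
    then show ?thesis
      using powr_mono2'[of s "1/2" u] powr_mono2'[of s u 1] assms by auto
  qed
  then show "u powr s \<le> max 1 ((1/2) powr s)" "min 1 ((1/2) powr s) \<le> u powr s" by auto
qed

text \<open>In terms of u = (1 - r) 2^n, which lies in [1/2, 1], the product equals u^(p-1) 2^n. The
  Besov weight times the p-th power of 2^n thus has the normalisation of the step functions
  above.\<close>

lemma dyadic_annulus_powr:
  fixes p :: real
  assumes r: "r \<in> dyadic_annulus n"
  shows "(1 - r) powr (p - 1) * (2 ^ n) powr p \<le> max 1 ((1/2) powr (p - 1)) * 2 ^ n"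
    and "min 1 ((1/2) powr (p - 1)) * 2 ^ n \<le> (1 - r) powr (p - 1) * (2 ^ n) powr p"
proof -
  define u where "u = (1 - r) * 2 ^ n"
  have u: "1/2 \<le> u" "u \<le> 1"
    using r by (auto simp: u_def dyadic_annulus_def field_simps power_divide)
  have "(1 - r) powr (p - 1) * (2 ^ n) powr p = (u powr (p - 1) / (2 ^ n) powr (p - 1)) * (2 ^ n) powr p"
    using u by (subst powr_divide[symmetric]) (auto simp: u_def)
  also have "\<dots> = u powr (p - 1) * 2 ^ n"
    by (simp add: powr_diff)
  finally show "(1 - r) powr (p - 1) * (2 ^ n) powr p \<le> max 1 ((1/2) powr (p - 1)) * 2 ^ n"
    "min 1 ((1/2) powr (p - 1)) * 2 ^ n \<le> (1 - r) powr (p - 1) * (2 ^ n) powr p"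
    using powr_half_bounds[OF u, of "p - 1"] by auto
qed

text \<open>Put p = q/2. On the annulus n the integrand is at most a multiple of 2^n D(n)^p and, for
  n \<ge> 1, at least a multiple of 2^n E(n)^p, where E are the block energies and D their geometric
  convolution. By \<open>geometric_convolution_bound\<close>, summability of E^p implies that of
  D^p.\<close>

theorem besov_half_iff_dyadic_summable:
  assumes q: "0 < q" and \<alpha>: "is_l2 \<alpha>"
  shows "besov_half q (\<lambda>z. \<Sum>n. \<alpha> n * z ^ n) \<longleftrightarrow> summable (\<lambda>n. dyadic_energy \<alpha> n powr (q / 2))"
proof -
  define p where "p = q / 2"
  have p: "0 < p" using q by (simp add: p_def)
  define h where "h = (\<lambda>r n. (real (Suc n))\<^sup>2 * (cmod (\<alpha> (Suc n)))\<^sup>2 * r ^ (2 * n))"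
  define \<phi> where "\<phi> = (\<lambda>r. (1 - r) powr (p - 1) * (2 * pi * suminf (h r)) powr p * r)"
  have hs: "summable (h r)" if "0 < r" "r < 1" for r
    using circle_mean_deriv(1)[OF \<alpha> that] by (simp add: h_def)
  have "(\<lambda>z. \<Sum>n. \<alpha> n * z ^ n) holomorphic_on ball 0 1"
    unfolding holomorphic_on_open[OF open_ball] using l2_power_series_deriv[OF \<alpha>] by fastforce
  moreover have "indicator {0<..<1} r * ennreal ((1 - r) powr (q/2 - 1) *
          (integral {0..2*pi} (\<lambda>\<theta>. (cmod (deriv (\<lambda>z. \<Sum>n. \<alpha> n * z ^ n) (complex_of_real r * cis \<theta>)))^2)) powr (q/2) * r)
      = indicator {0<..<1} r * ennreal (\<phi> r)" for r
    using circle_mean_deriv(2)[OF \<alpha>, of r] by (auto simp: indicator_def \<phi>_def h_def p_def)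
  ultimately have iff: "besov_half q (\<lambda>z. \<Sum>n. \<alpha> n * z ^ n)
      \<longleftrightarrow> (\<integral>\<^sup>+ r. indicator {0<..<1} r * ennreal (\<phi> r) \<partial>lborel) < \<infinity>"
    by (simp add: besov_half_def)
  show ?thesis
  proof
    assume "besov_half q (\<lambda>z. \<Sum>n. \<alpha> n * z ^ n)"
    then have fin: "(\<integral>\<^sup>+ r. indicator {0<..<1} r * ennreal (\<phi> r) \<partial>lborel) < \<infinity>" using iff by simp
    \<comment> \<open>The factor 2\<pi> comes from Parseval, 256 from
      \<open>derivative_mean_ge_dyadic_energy\<close>, and the final 1/2 from r \<ge> 1/2 in the
      last factor of the integrand.\<close>
    define c where "c = min 1 ((1/2) powr (p - 1)) * (2 * pi / 256) powr p / 2"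
    have c: "0 < c" by (simp add: c_def)
    define b where "b = (\<lambda>n. if n = 0 then 0 else c * dyadic_energy \<alpha> n powr p)"
    have "(\<Sum>n. ennreal (b n / 2)) \<le> (\<integral>\<^sup>+ r. indicator {0<..<1} r * ennreal (\<phi> r) \<partial>lborel)"
    proof (rule nn_integral_unit_ge_dyadic)
      show "0 \<le> b n" for n using c by (simp add: b_def)
      show "b 0 = 0" by (simp add: b_def)
      fix n :: nat and r assume n: "1 \<le> n" and r: "r \<in> dyadic_annulus n"
      have "(1/2 :: real) ^ n \<le> (1/2) ^ 1" "0 < (1/2 :: real) ^ (n + 1)"
        using n by (intro power_decreasing, auto)
      then have r01: "1/2 \<le> r" "r < 1" using r by (auto simp: dyadic_annulus_def)
      let ?E = "dyadic_energy \<alpha> n"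
      have "2 ^ n * ?E / 256 \<le> suminf (h r)"
        using derivative_mean_ge_dyadic_energy[OF n _ _ hs[of r, unfolded h_def]] r r01
        by (auto simp: h_def dyadic_annulus_def)
      then have "(2 * pi * (2 ^ n * ?E / 256)) powr p \<le> (2 * pi * suminf (h r)) powr p"
        using p by (intro powr_mono2 mult_left_mono) auto
      moreover have "(2 * pi * (2 ^ n * ?E / 256)) powr p = (2 ^ n) powr p * ((2 * pi / 256) powr p * ?E powr p)"
      proof -
        have "2 * pi * (2 ^ n * ?E / 256) = 2 ^ n * ((2 * pi / 256) * ?E)" by simp
        then show ?thesis by (simp only: powr_mult dyadic_energy_nonneg zero_le_power mult_nonneg_nonneg
            pi_ge_zero divide_nonneg_nonneg zero_le_numeral)
      qed
      ultimately have 1: "(2 ^ n) powr p * ((2 * pi / 256) powr p * ?E powr p) \<le> (2 * pi * suminf (h r)) powr p"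
        by simp
      have "2 ^ n * b n = (min 1 ((1/2) powr (p - 1)) * 2 ^ n) * ((2 * pi / 256) powr p * ?E powr p) * (1/2)"
        using n by (simp add: b_def c_def)
      also have "\<dots> \<le> ((1 - r) powr (p - 1) * (2 ^ n) powr p) * ((2 * pi / 256) powr p * ?E powr p) * r"
        by (rule mult_mono[OF mult_right_mono[OF dyadic_annulus_powr(2)[OF r]]]) (use r01 in auto)
      also have "\<dots> = (1 - r) powr (p - 1) * ((2 ^ n) powr p * ((2 * pi / 256) powr p * ?E powr p)) * r"
        by simp
      also have "\<dots> \<le> \<phi> r"
        unfolding \<phi>_def using r01 by (intro mult_right_mono mult_left_mono 1) auto
      finally show "2 ^ n * b n \<le> \<phi> r" .
    qed
    also note fin
    finally have "summable (\<lambda>n. b n / 2)"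
      using c by (intro summable_suminf_not_top) (auto simp: b_def)
    then have "summable (\<lambda>n. 2 / c * (b (Suc n) / 2))"
      by (intro summable_mult) (simp add: summable_Suc_iff)
    then have "summable (\<lambda>n. dyadic_energy \<alpha> (Suc n) powr p)"
      using c by (simp add: b_def)
    then show "summable (\<lambda>n. dyadic_energy \<alpha> n powr (q / 2))"
      using summable_Suc_iff[of "\<lambda>n. dyadic_energy \<alpha> n powr p"] by (simp add: p_def)
  next
    assume "summable (\<lambda>n. dyadic_energy \<alpha> n powr (q / 2))"
    then have sE: "summable (\<lambda>n. dyadic_energy \<alpha> n powr p)" by (simp add: p_def)
    define D where "D = (\<lambda>n. \<Sum>m. (1/2) ^ ((n - m) + (m - n)) * dyadic_energy \<alpha> m)"
    have "(\<forall>n. summable (\<lambda>m. (1/2) ^ ((n - m) + (m - n)) * dyadic_energy \<alpha> m)) \<and> summable (\<lambda>n. D n powr p)"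
    proof -
      obtain C where "\<forall>a. (\<forall>m. 0 \<le> a m) \<longrightarrow> summable (\<lambda>m. a m powr p) \<longrightarrow>
           (\<forall>n. summable (\<lambda>m::nat. (1/2) ^ ((n - m) + (m - n)) * a m)) \<and>
           summable (\<lambda>n::nat. (\<Sum>m. (1/2) ^ ((n - m) + (m - n)) * a m) powr p) \<and>
           (\<Sum>n::nat. (\<Sum>m. (1/2) ^ ((n - m) + (m - n)) * a m) powr p) \<le> C * (\<Sum>m. a m powr p)"
        using geometric_convolution_bound[of "1/2" p] p by auto
      from this[rule_format, of "dyadic_energy \<alpha>"] show ?thesis using sE by (auto simp: D_def)
    qed
    then have D: "\<And>n. summable (\<lambda>m. (1/2) ^ ((n - m) + (m - n)) * dyadic_energy \<alpha> m)"
      "summable (\<lambda>n. D n powr p)" by auto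
    \<comment> \<open>Here 64\<pi> is 2\<pi> from Parseval times 32 from
      \<open>derivative_mean_le_dyadic_energy\<close>; the last factor r is bounded by 1.\<close>
    define c where "c = max 1 ((1/2) powr (p - 1)) * (64 * pi) powr p"
    have D0: "0 \<le> D n" for n unfolding D_def by (intro suminf_nonneg D) auto
    have c: "0 \<le> c" by (simp add: c_def le_max_iff_disj)
    have "(\<integral>\<^sup>+ r. indicator {0<..<1} r * ennreal (\<phi> r) \<partial>lborel) \<le> (\<Sum>n. ennreal (c * D n powr p / 2))"
    proof (rule nn_integral_unit_le_dyadic)
      show "0 \<le> c * D n powr p" for n using c by simp
      fix n r assume r: "r \<in> dyadic_annulus n" and r0: "0 < r"
      have "0 < (1/2 :: real) ^ (n + 1)" by simp
      then have r1: "r < 1" using r unfolding dyadic_annulus_def by simp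
      have "suminf (h r) \<le> 32 * 2 ^ n * D n"
        using derivative_mean_le_dyadic_energy[OF r0 _ hs[of r, unfolded h_def] D(1)] r r0 r1
        by (auto simp: h_def D_def dyadic_annulus_def)
      moreover have "0 \<le> suminf (h r)" using r0 by (intro suminf_nonneg hs r0 r1) (simp add: h_def)
      ultimately have "(2 * pi * suminf (h r)) powr p \<le> (2 * pi * (32 * 2 ^ n * D n)) powr p"
        using p by (intro powr_mono2 mult_left_mono) auto
      also have "\<dots> = (2 ^ n) powr p * ((64 * pi) powr p * D n powr p)"
      proof -
        have "2 * pi * (32 * 2 ^ n * D n) = 2 ^ n * ((64 * pi) * D n)" by simp
        then show ?thesis by (simp only: powr_mult D0 zero_le_power mult_nonneg_nonneg
            pi_ge_zero zero_le_numeral)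
      qed
      finally have 1: "(2 * pi * suminf (h r)) powr p \<le> (2 ^ n) powr p * ((64 * pi) powr p * D n powr p)" .
      have "\<phi> r \<le> (1 - r) powr (p - 1) * ((2 ^ n) powr p * ((64 * pi) powr p * D n powr p)) * 1"
        unfolding \<phi>_def using r0 r1 by (intro mult_mono 1) auto
      also have "\<dots> = ((1 - r) powr (p - 1) * (2 ^ n) powr p) * ((64 * pi) powr p * D n powr p)"
        by simp
      also have "\<dots> \<le> (max 1 ((1/2) powr (p - 1)) * 2 ^ n) * ((64 * pi) powr p * D n powr p)"
        by (intro mult_right_mono dyadic_annulus_powr r) auto
      finally show "\<phi> r \<le> 2 ^ n * (c * D n powr p)" by (simp add: c_def mult_ac)
    qed
    also have "\<dots> < \<infinity>"
    proof -
      have "summable (\<lambda>n. c * D n powr p / 2)" using D(2) by (intro summable_divide summable_mult)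
      then show ?thesis using c by (simp add: ennreal_suminf_neq_top less_top)
    qed
    finally show "besov_half q (\<lambda>z. \<Sum>n. \<alpha> n * z ^ n)" using iff by simp
  qed
qed

section \<open>Finite-rank approximation of Rhaly operators\<close>

text \<open>Cauchy-Schwarz on each block bounds a partial sum reaching into block n by 2 * 2^(n/2)
  T(n), where T is a geometric convolution of the block norms of f. Squared, the factor 2^n
  completes the block energy of \<beta>, and the l2 bound for T finishes. C is quantified first so
  as to be uniform in \<beta>, l and f.\<close>

lemma hardy_dyadic_bound:
  shows "\<exists>C\<ge>0. \<forall>\<beta> l f. 0 \<le> l \<longrightarrow> cmod (\<beta> 0) \<le> l \<longrightarrow> (\<forall>n. dyadic_energy \<beta> n \<le> l\<^sup>2) \<longrightarrow> is_l2 f \<longrightarrow>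
           is_l2 (rhaly \<beta> f) \<and>
           (\<Sum>k. (cmod (rhaly \<beta> f k))\<^sup>2) \<le> C * l\<^sup>2 * (\<Sum>k. (cmod (f k))\<^sup>2)"
proof -
  \<comment> \<open>Block m enters with the Cauchy-Schwarz factor 2^(m/2) = 2^(n/2) \<rho>^(n-m),
    which fixes the ratio.\<close>
  define \<rho> :: real where "\<rho> = 1 / sqrt 2"
  have \<rho>: "0 < \<rho>" "\<rho> < 1" by (auto simp: \<rho>_def)
  obtain C where C: "0 \<le> C" "\<forall>a. (\<forall>m. 0 \<le> a m) \<longrightarrow> summable (\<lambda>m. a m powr 2) \<longrightarrow>
           (\<forall>n. summable (\<lambda>m::nat. \<rho> ^ ((n - m) + (m - n)) * a m)) \<and>
           summable (\<lambda>n::nat. (\<Sum>m. \<rho> ^ ((n - m) + (m - n)) * a m) powr 2) \<and>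
           (\<Sum>n::nat. (\<Sum>m. \<rho> ^ ((n - m) + (m - n)) * a m) powr 2) \<le> C * (\<Sum>m. a m powr 2)"
    using geometric_convolution_bound[OF \<rho>, of 2] by auto
  show ?thesis
  \<comment> \<open>The summand 1 pays for row 0, and 4 is the square of the factor 2 in the bound
    for partial sums.\<close>
  proof (rule exI[of _ "1 + 4 * C"], intro conjI allI impI)
    show "0 \<le> 1 + 4 * C" using C by simp
    fix \<beta> f :: "nat \<Rightarrow> complex" and l :: real
    assume l: "0 \<le> l" and \<beta>0: "cmod (\<beta> 0) \<le> l" and \<beta>: "\<forall>n. dyadic_energy \<beta> n \<le> l\<^sup>2" and f: "is_l2 f"
    define S where "S = (\<Sum>k. (cmod (f k))\<^sup>2)"
    have fs: "summable (\<lambda>k. (cmod (f k))\<^sup>2)" using f by (simp add: is_l2_def)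
    have part: "(\<Sum>k\<in>A. (cmod (f k))\<^sup>2) \<le> S" if "finite A" for A
      unfolding S_def by (intro sum_le_suminf fs that) auto
    have S0: "0 \<le> S" using part[of "{}"] by simp
    \<comment> \<open>The entry f(0) belongs to no block and is added to block 0.\<close>
    define F where "F = (\<lambda>m. (\<Sum>j\<in>{2 ^ m..<2 ^ (m + 1)}. (cmod (f j))\<^sup>2) + (if m = 0 then (cmod (f 0))\<^sup>2 else 0))"
    define t where "t = (\<lambda>m. sqrt (F m))"
    have F0: "0 \<le> F m" for m by (auto simp: F_def intro!: add_nonneg_nonneg sum_nonneg)
    have t0: "0 \<le> t m" for m by (simp add: t_def F0)
    have t2: "t m powr 2 = F m" for m using F0[of m] by (simp add: t_def)
    have Fpart: "(\<Sum>m<N. F m) \<le> S" for N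
    proof -
      have "(\<Sum>m<N. F m) \<le> (\<Sum>m<N. \<Sum>j\<in>{2 ^ m..<2 ^ (m + 1)}. (cmod (f j))\<^sup>2) + (cmod (f 0))\<^sup>2"
        unfolding F_def sum.distrib by (intro add_left_mono) (simp add: sum.delta)
      also have "\<dots> = (\<Sum>j\<in>{1..<2 ^ N}. (cmod (f j))\<^sup>2) + (\<Sum>j\<in>{0}. (cmod (f j))\<^sup>2)"
        by (simp only: sum_dyadic_blocks) simp
      also have "\<dots> = (\<Sum>j\<in>{1..<2 ^ N} \<union> {0}. (cmod (f j))\<^sup>2)"
        by (intro sum.union_disjoint[symmetric]) auto
      also have "\<dots> \<le> S" by (rule part) simp
      finally show ?thesis .
    qed
    have Fs: "summable F"
      by (rule summableI_nonneg_bounded[OF F0 Fpart])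
    have FS: "suminf F \<le> S" by (rule suminf_le_const[OF Fs Fpart])
    define T where "T = (\<lambda>n. \<Sum>m. \<rho> ^ ((n - m) + (m - n)) * t m)"
    have conv: "summable (\<lambda>m. \<rho> ^ ((n - m) + (m - n)) * t m)" "summable (\<lambda>n. T n powr 2)"
      "(\<Sum>n. T n powr 2) \<le> C * suminf F" for n
      using C(2)[rule_format, of t] t0 Fs by (auto simp: t2 T_def)
    have T0: "0 \<le> T n" for n unfolding T_def using \<rho> t0 by (intro suminf_nonneg conv) auto
    have T2: "(\<lambda>n. T n powr 2) = (\<lambda>n. (T n)\<^sup>2)" using T0 by auto
    have TS: "(\<Sum>n<N. (T n)\<^sup>2) \<le> C * S" for N
    proof -
      have "(\<Sum>n<N. (T n)\<^sup>2) \<le> (\<Sum>n. (T n)\<^sup>2)" using conv(2) by (intro sum_le_suminf) (auto simp: T2)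
      also have "\<dots> \<le> C * suminf F" using conv(3) by (simp add: T2)
      also have "\<dots> \<le> C * S" using C(1) FS by (intro mult_left_mono)
      finally show ?thesis .
    qed
    have partial: "cmod (\<Sum>j\<le>k. f j) \<le> 2 * sqrt 2 ^ n * T n" if k: "k < 2 ^ (n + 1)" for k n
    proof -
      have block: "(\<Sum>j\<in>{2 ^ m..<2 ^ (m + 1)}. cmod (f j)) \<le> sqrt 2 ^ m * t m" for m
      proof -
        have "(\<Sum>j\<in>{2 ^ m..<2 ^ (m + 1)}. 1 * cmod (f j))\<^sup>2
            \<le> (\<Sum>j\<in>{2 ^ m..<2 ^ (m + 1)::nat}. 1\<^sup>2) * (\<Sum>j\<in>{2 ^ m..<2 ^ (m + 1)}. (cmod (f j))\<^sup>2)"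
          by (rule Cauchy_Schwarz_ineq_sum)
        also have "\<dots> \<le> 2 ^ m * F m"
          by (auto simp: F_def intro!: mult_left_mono)
        finally have "(\<Sum>j\<in>{2 ^ m..<2 ^ (m + 1)}. cmod (f j)) \<le> sqrt (2 ^ m * F m)"
          by (intro real_le_rsqrt) simp
        then show ?thesis by (simp add: real_sqrt_mult real_sqrt_power t_def)
      qed
      have f0: "cmod (f 0) \<le> t 0"
        unfolding t_def by (intro real_le_rsqrt) (simp add: F_def sum_nonneg)
      have "cmod (\<Sum>j\<le>k. f j) \<le> (\<Sum>j\<le>k. cmod (f j))" by (rule norm_sum)
      also have "\<dots> \<le> (\<Sum>j\<in>{0} \<union> {1..<2 ^ Suc n}. cmod (f j))"
        using k by (intro sum_mono2) auto
      also have "\<dots> = cmod (f 0) + (\<Sum>j\<in>{1..<2 ^ Suc n}. cmod (f j))"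
        by (subst sum.union_disjoint) auto
      also have "\<dots> = cmod (f 0) + (\<Sum>m<Suc n. \<Sum>j\<in>{2 ^ m..<2 ^ (m + 1)}. cmod (f j))"
        by (simp only: sum_dyadic_blocks)
      \<comment> \<open>The extra term |f(0)| is absorbed by a second copy of the sum, whence the
        factor 2.\<close>
      also have "\<dots> \<le> (\<Sum>m<Suc n. sqrt 2 ^ m * t m) + (\<Sum>m<Suc n. sqrt 2 ^ m * t m)"
      proof (intro add_mono sum_mono block)
        have "cmod (f 0) \<le> (\<Sum>m\<in>{0}. sqrt 2 ^ m * t m)" using f0 by simp
        also have "\<dots> \<le> (\<Sum>m<Suc n. sqrt 2 ^ m * t m)"
          using t0 by (intro sum_mono2) auto
        finally show "cmod (f 0) \<le> (\<Sum>m<Suc n. sqrt 2 ^ m * t m)" .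
      qed
      also have "\<dots> = 2 * (\<Sum>m<Suc n. sqrt 2 ^ m * t m)" by simp
      also have "(\<Sum>m<Suc n. sqrt 2 ^ m * t m) = (\<Sum>m<Suc n. sqrt 2 ^ n * (\<rho> ^ ((n - m) + (m - n)) * t m))"
      proof (rule sum.cong)
        fix m assume "m \<in> {..<Suc n}"
        then have "sqrt 2 ^ m = sqrt 2 ^ n * \<rho> ^ (n - m)" and "m - n = 0"
          by (auto simp: \<rho>_def power_divide power_diff)
        then show "sqrt 2 ^ m * t m = sqrt 2 ^ n * (\<rho> ^ ((n - m) + (m - n)) * t m)" by simp
      qed simp
      also have "\<dots> = sqrt 2 ^ n * (\<Sum>m<Suc n. \<rho> ^ ((n - m) + (m - n)) * t m)"
        by (rule sum_distrib_left[symmetric])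
      also have "2 * (sqrt 2 ^ n * (\<Sum>m<Suc n. \<rho> ^ ((n - m) + (m - n)) * t m)) \<le> 2 * (sqrt 2 ^ n * T n)"
        unfolding T_def using \<rho> t0 by (intro mult_left_mono sum_le_suminf conv) auto
      finally show ?thesis by (simp add: mult.assoc)
    qed
    have block: "(\<Sum>k\<in>{2 ^ n..<2 ^ (n + 1)}. (cmod (rhaly \<beta> f k))\<^sup>2) \<le> 4 * l\<^sup>2 * (T n)\<^sup>2" for n
    proof -
      have "(\<Sum>k\<in>{2 ^ n..<2 ^ (n + 1)}. (cmod (rhaly \<beta> f k))\<^sup>2)
          \<le> (\<Sum>k\<in>{2 ^ n..<2 ^ (n + 1)}. (cmod (\<beta> k))\<^sup>2 * (2 * sqrt 2 ^ n * T n)\<^sup>2)"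
        unfolding rhaly_def norm_mult power_mult_distrib[of "cmod (\<beta> _)"]
        by (intro sum_mono mult_left_mono power_mono partial) auto
      also have "\<dots> = (2 * sqrt 2 ^ n * T n)\<^sup>2 * (\<Sum>k\<in>{2 ^ n..<2 ^ (n + 1)}. (cmod (\<beta> k))\<^sup>2)"
        by (simp add: sum_distrib_left mult.commute)
      also have "(2 * sqrt 2 ^ n * T n)\<^sup>2 = 2 ^ n * (4 * (T n)\<^sup>2)"
      proof -
        have "(sqrt 2 ^ n)\<^sup>2 = 2 ^ n" by (simp add: power_mult[symmetric] mult.commute[of n] power_mult)
        then show ?thesis by (simp add: power_mult_distrib)
      qed
      also have "2 ^ n * (4 * (T n)\<^sup>2) * (\<Sum>k\<in>{2 ^ n..<2 ^ (n + 1)}. (cmod (\<beta> k))\<^sup>2) = dyadic_energy \<beta> n * (4 * (T n)\<^sup>2)"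
        by (simp add: dyadic_energy_def)
      also have "\<dots> \<le> l\<^sup>2 * (4 * (T n)\<^sup>2)" using \<beta> by (intro mult_right_mono) auto
      finally show ?thesis by simp
    qed
    have bound: "(\<Sum>k<N. (cmod (rhaly \<beta> f k))\<^sup>2) \<le> (1 + 4 * C) * l\<^sup>2 * S" for N
    proof -
      have "(\<Sum>k<N. (cmod (rhaly \<beta> f k))\<^sup>2) \<le> (\<Sum>k\<in>{0} \<union> {1..<2 ^ N}. (cmod (rhaly \<beta> f k))\<^sup>2)"
        using less_trans[OF _ less_exp[of N]] by (intro sum_mono2) auto
      also have "\<dots> = (cmod (rhaly \<beta> f 0))\<^sup>2 + (\<Sum>n<N. \<Sum>k\<in>{2 ^ n..<2 ^ (n + 1)}. (cmod (rhaly \<beta> f k))\<^sup>2)"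
        unfolding sum_dyadic_blocks[symmetric] by (subst sum.union_disjoint) auto
      also have "\<dots> \<le> l\<^sup>2 * S + (\<Sum>n<N. 4 * l\<^sup>2 * (T n)\<^sup>2)"
      proof (intro add_mono sum_mono block)
        have "(cmod (\<beta> 0))\<^sup>2 * (cmod (f 0))\<^sup>2 \<le> l\<^sup>2 * S"
          using part[of "{0}"] \<beta>0 l by (intro mult_mono power_mono) auto
        then show "(cmod (rhaly \<beta> f 0))\<^sup>2 \<le> l\<^sup>2 * S" by (simp add: rhaly_def norm_mult power_mult_distrib)
      qed
      also have "(\<Sum>n<N. 4 * l\<^sup>2 * (T n)\<^sup>2) = 4 * l\<^sup>2 * (\<Sum>n<N. (T n)\<^sup>2)" by (rule sum_distrib_left[symmetric])
      also have "l\<^sup>2 * S + 4 * l\<^sup>2 * (\<Sum>n<N. (T n)\<^sup>2) \<le> l\<^sup>2 * S + 4 * l\<^sup>2 * (C * S)"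
        by (intro add_left_mono mult_left_mono TS) auto
      finally show ?thesis by (simp add: algebra_simps)
    qed
    have s: "summable (\<lambda>k. (cmod (rhaly \<beta> f k))\<^sup>2)"
      by (rule summableI_nonneg_bounded[OF _ bound]) simp
    then show "is_l2 (rhaly \<beta> f)" by (simp add: is_l2_def)
    show "(\<Sum>k. (cmod (rhaly \<beta> f k))\<^sup>2) \<le> (1 + 4 * C) * l\<^sup>2 * (\<Sum>k. (cmod (f k))\<^sup>2)"
      using suminf_le_const[OF s bound] by (simp add: S_def)
  qed
qed

section \<open>Subdivision of a block into intervals of small energy\<close>

definition interval_energy :: "(nat \<Rightarrow> complex) \<Rightarrow> nat \<Rightarrow> nat \<Rightarrow> real" where
  "interval_energy \<alpha> a b = real (b - a) * (\<Sum>k\<in>{a..<b}. (cmod (\<alpha> k))\<^sup>2)"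

lemma interval_energy_nonneg [simp]: "0 \<le> interval_energy \<alpha> a b"
  by (simp add: interval_energy_def sum_nonneg)

lemma interval_energy_dyadic: "interval_energy \<alpha> (2 ^ n) (2 ^ (n + 1)) = dyadic_energy \<alpha> n"
  by (simp add: interval_energy_def dyadic_energy_def of_nat_diff)

text \<open>After squaring, the cross term is handled by 2 sqrt(xX yY) \<le> xY + yX. Consecutive
  intervals therefore share the root energy of their union, which limits how many of them can have
  large energy.\<close>

lemma sqrt_interval_energy_superadditive:
  assumes "a \<le> c" "c \<le> b"
  shows "sqrt (interval_energy \<alpha> a c) + sqrt (interval_energy \<alpha> c b) \<le> sqrt (interval_energy \<alpha> a b)"
proof -
  define x y where "x = real (c - a)" and "y = real (b - c)"
  define X Y where "X = (\<Sum>k\<in>{a..<c}. (cmod (\<alpha> k))\<^sup>2)" and "Y = (\<Sum>k\<in>{c..<b}. (cmod (\<alpha> k))\<^sup>2)"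
  have nn: "0 \<le> x" "0 \<le> y" "0 \<le> X" "0 \<le> Y" by (auto simp: x_def y_def X_def Y_def sum_nonneg)
  have sum: "real (b - a) = x + y" "(\<Sum>k\<in>{a..<b}. (cmod (\<alpha> k))\<^sup>2) = X + Y"
    using assms by (auto simp: x_def y_def X_def Y_def sum.atLeastLessThan_concat of_nat_diff)
  have "2 * (sqrt (x * X) * sqrt (y * Y)) = 2 * sqrt ((x * Y) * (y * X))"
    by (simp add: real_sqrt_mult)
  also have "\<dots> \<le> x * Y + y * X"
    using arith_geo_mean_sqrt[of "x * Y" "y * X"] nn by simp
  finally have "(sqrt (x * X) + sqrt (y * Y))\<^sup>2 \<le> (x + y) * (X + Y)"
    using nn by (simp add: power2_sum algebra_simps)
  then have "sqrt (x * X) + sqrt (y * Y) \<le> sqrt ((x + y) * (X + Y))" by (rule real_le_rsqrt)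
  then show ?thesis by (simp add: interval_energy_def sum) (simp add: x_def y_def X_def Y_def)
qed

text \<open>Each row is estimated by Cauchy-Schwarz over all of [a, b) instead of [a, k]; the root
  of \<open>interval_energy\<close> thus bounds the norm of the triangle cut out by the
  interval.\<close>

lemma triangular_block_bound:
  "(\<Sum>k\<in>{a..<b}. (cmod (\<alpha> k * (\<Sum>j\<in>{a..k}. f j)))\<^sup>2)
     \<le> interval_energy \<alpha> a b * (\<Sum>j\<in>{a..<b}. (cmod (f j))\<^sup>2)"
proof -
  let ?F = "\<Sum>j\<in>{a..<b}. (cmod (f j))\<^sup>2"
  have "(cmod (\<alpha> k * (\<Sum>j\<in>{a..k}. f j)))\<^sup>2 \<le> (cmod (\<alpha> k))\<^sup>2 * (real (b - a) * ?F)"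
    if k: "k \<in> {a..<b}" for k
  proof -
    have "cmod (\<Sum>j\<in>{a..k}. f j) \<le> (\<Sum>j\<in>{a..k}. cmod (f j))" by (rule norm_sum)
    also have "\<dots> \<le> (\<Sum>j\<in>{a..<b}. cmod (f j))" using k by (intro sum_mono2) auto
    finally have "(cmod (\<Sum>j\<in>{a..k}. f j))\<^sup>2 \<le> (\<Sum>j\<in>{a..<b}. 1 * cmod (f j))\<^sup>2"
      by (simp add: power_mono)
    also have "\<dots> \<le> (\<Sum>j\<in>{a..<b}. 1\<^sup>2) * ?F" by (rule Cauchy_Schwarz_ineq_sum)
    finally show ?thesis by (simp add: norm_mult power_mult_distrib mult_left_mono)
  qed
  then have "(\<Sum>k\<in>{a..<b}. (cmod (\<alpha> k * (\<Sum>j\<in>{a..k}. f j)))\<^sup>2)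
      \<le> (\<Sum>k\<in>{a..<b}. (cmod (\<alpha> k))\<^sup>2 * (real (b - a) * ?F))"
    by (rule sum_mono)
  also have "\<dots> = interval_energy \<alpha> a b * ?F"
    unfolding interval_energy_def sum_distrib_right[symmetric] by (simp only: mult_ac)
  finally show ?thesis .
qed

text \<open>Cut off maximal initial intervals on which the energy stays below \<open>l\<^sup>2\<close>. The row
  following such an interval is treated exactly (\<open>c k = Suc k\<close>), and by superadditivity the
  number of cuts is controlled by the square root of the total energy.\<close>

lemma greedy_partition:
  assumes l: "0 < l"
  shows "\<exists>c. real (card (c ` {a..<b})) \<le> 2 * sqrt (interval_energy \<alpha> a b) / l + 1 \<and>
             (\<forall>k\<in>{a..<b}. c k \<le> Suc k) \<and>
             (\<forall>f. (\<Sum>k\<in>{a..<b}. (cmod (\<alpha> k * (\<Sum>j\<in>{c k..k}. f j)))\<^sup>2)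
                    \<le> l\<^sup>2 * (\<Sum>j\<in>{a..<b}. (cmod (f j))\<^sup>2))"
proof (induction "b - a" arbitrary: a rule: less_induct)
  case less
  show ?case
  proof (cases "sqrt (interval_energy \<alpha> a b) \<le> l")
    case True
    then have le: "interval_energy \<alpha> a b \<le> l\<^sup>2" using sqrt_le_D by blast
    have "card ((\<lambda>_. a) ` {a..<b}) \<le> card {a}" by (intro card_mono) auto
    moreover have "0 \<le> sqrt (interval_energy \<alpha> a b) / l" using l by simp
    ultimately have "real (card ((\<lambda>_. a) ` {a..<b})) \<le> 2 * sqrt (interval_energy \<alpha> a b) / l + 1"
      by simp
    moreover have "(\<Sum>k\<in>{a..<b}. (cmod (\<alpha> k * (\<Sum>j\<in>{a..k}. f j)))\<^sup>2)
        \<le> l\<^sup>2 * (\<Sum>j\<in>{a..<b}. (cmod (f j))\<^sup>2)" for f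
      by (rule order_trans[OF triangular_block_bound mult_right_mono[OF le]]) (simp add: sum_nonneg)
    ultimately show ?thesis by (intro exI[of _ "\<lambda>_. a"]) auto
  next
    case False
    \<comment> \<open>The energy first exceeds l^2 at the endpoint e; the interval [a, e - 1) is
      still good, and row d = e - 1 is the one treated exactly.\<close>
    define e where "e = (LEAST e. l < sqrt (interval_energy \<alpha> a e))"
    have e: "l < sqrt (interval_energy \<alpha> a e)" "e \<le> b"
      unfolding e_def using False
        LeastI[of "\<lambda>e. l < sqrt (interval_energy \<alpha> a e)" b]
        Least_le[of "\<lambda>e. l < sqrt (interval_energy \<alpha> a e)" b] by auto
    have "\<not> e \<le> a" using e(1) l by (auto simp: interval_energy_def)
    then obtain d where d: "e = Suc d" "a \<le> d" by (cases e) auto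
    have "\<not> l < sqrt (interval_energy \<alpha> a d)"
      using not_less_Least[of d "\<lambda>e. l < sqrt (interval_energy \<alpha> a e)"] d unfolding e_def[symmetric] by simp
    then have le: "interval_energy \<alpha> a d \<le> l\<^sup>2" using sqrt_le_D by fastforce
    obtain c where c: "real (card (c ` {e..<b})) \<le> 2 * sqrt (interval_energy \<alpha> e b) / l + 1"
      "\<forall>k\<in>{e..<b}. c k \<le> Suc k"
      "\<And>f. (\<Sum>k\<in>{e..<b}. (cmod (\<alpha> k * (\<Sum>j\<in>{c k..k}. f j)))\<^sup>2)
                    \<le> l\<^sup>2 * (\<Sum>j\<in>{e..<b}. (cmod (f j))\<^sup>2)"
    proof -
      have "b - e < b - a" using d e by simp
      from less[OF this] show ?thesis using that by blast
    qed
    define c' where "c' = (\<lambda>k. if k < d then a else if k = d then Suc d else c k)"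
    have split: "{a..<b} = {a..<d} \<union> ({d} \<union> {e..<b})" using d e by auto
    have "card (c' ` {a..<b}) \<le> card ({a, Suc d} \<union> c ` {e..<b})"
      by (intro card_mono) (use d in \<open>auto simp: c'_def\<close>)
    also have "\<dots> \<le> card {a, Suc d} + card (c ` {e..<b})" by (rule card_Un_le)
    also have "\<dots> \<le> 2 + card (c ` {e..<b})" by (simp add: card_insert_if)
    finally have "real (card (c' ` {a..<b})) \<le> 2 + real (card (c ` {e..<b}))" by linarith
    \<comment> \<open>The two new values a and \<open>Suc d\<close> cost 2, which is charged to the
      interval [a, e), whose root energy exceeds l.\<close>
    also have "\<dots> \<le> 2 * (l / l) + (2 * sqrt (interval_energy \<alpha> e b) / l + 1)" using c(1) l by simp
    also have "\<dots> \<le> 2 * (sqrt (interval_energy \<alpha> a e) / l) + (2 * sqrt (interval_energy \<alpha> e b) / l + 1)"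
      using e(1) l by (intro add_right_mono mult_left_mono divide_right_mono) auto
    also have "\<dots> = 2 * (sqrt (interval_energy \<alpha> a e) + sqrt (interval_energy \<alpha> e b)) / l + 1"
      by (simp add: add_divide_distrib distrib_left)
    also have "\<dots> \<le> 2 * sqrt (interval_energy \<alpha> a b) / l + 1"
      using sqrt_interval_energy_superadditive[of a e b \<alpha>] d e l
      by (intro add_right_mono divide_right_mono) auto
    finally have card: "real (card (c' ` {a..<b})) \<le> 2 * sqrt (interval_energy \<alpha> a b) / l + 1" .
    have "(\<Sum>k\<in>{a..<b}. (cmod (\<alpha> k * (\<Sum>j\<in>{c' k..k}. f j)))\<^sup>2) \<le> l\<^sup>2 * (\<Sum>j\<in>{a..<b}. (cmod (f j))\<^sup>2)" for f
    proof -
      have "(\<Sum>k\<in>{a..<b}. (cmod (\<alpha> k * (\<Sum>j\<in>{c' k..k}. f j)))\<^sup>2)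
          = (\<Sum>k\<in>{a..<d}. (cmod (\<alpha> k * (\<Sum>j\<in>{c' k..k}. f j)))\<^sup>2)
            + ((cmod (\<alpha> d * (\<Sum>j\<in>{c' d..d}. f j)))\<^sup>2
            + (\<Sum>k\<in>{e..<b}. (cmod (\<alpha> k * (\<Sum>j\<in>{c' k..k}. f j)))\<^sup>2))"
        unfolding split using d by (subst sum.union_disjoint; auto)
      also have "(\<Sum>k\<in>{a..<d}. (cmod (\<alpha> k * (\<Sum>j\<in>{c' k..k}. f j)))\<^sup>2)
          = (\<Sum>k\<in>{a..<d}. (cmod (\<alpha> k * (\<Sum>j\<in>{a..k}. f j)))\<^sup>2)"
        by (intro sum.cong) (auto simp: c'_def)
      also have "(\<Sum>k\<in>{e..<b}. (cmod (\<alpha> k * (\<Sum>j\<in>{c' k..k}. f j)))\<^sup>2)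
          = (\<Sum>k\<in>{e..<b}. (cmod (\<alpha> k * (\<Sum>j\<in>{c k..k}. f j)))\<^sup>2)"
        using d by (intro sum.cong) (auto simp: c'_def)
      also have "(cmod (\<alpha> d * (\<Sum>j\<in>{c' d..d}. f j)))\<^sup>2 = 0" by (simp add: c'_def)
      also have "(\<Sum>k\<in>{a..<d}. (cmod (\<alpha> k * (\<Sum>j\<in>{a..k}. f j)))\<^sup>2)
            + (0 + (\<Sum>k\<in>{e..<b}. (cmod (\<alpha> k * (\<Sum>j\<in>{c k..k}. f j)))\<^sup>2))
          \<le> l\<^sup>2 * (\<Sum>j\<in>{a..<d}. (cmod (f j))\<^sup>2) + (l\<^sup>2 * (cmod (f d))\<^sup>2 + l\<^sup>2 * (\<Sum>j\<in>{e..<b}. (cmod (f j))\<^sup>2))"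
        by (intro add_mono c(3) order_trans[OF triangular_block_bound mult_right_mono[OF le]])
          (simp_all add: sum_nonneg)
      also have "\<dots> = l\<^sup>2 * (\<Sum>j\<in>{a..<b}. (cmod (f j))\<^sup>2)"
        unfolding split using d by (subst sum.union_disjoint; auto simp: distrib_left)
      finally show ?thesis .
    qed
    moreover have "\<forall>k\<in>{a..<b}. c' k \<le> Suc k" using c(2) d by (auto simp: c'_def)
    ultimately show ?thesis using card by (intro exI[of _ c']) blast
  qed
qed

section \<open>Elementary estimates for operator norms and approximation numbers\<close>

lemma op_norm_le:
  assumes K: "0 \<le> K"
    and T: "\<And>f. is_l2 f \<Longrightarrow> is_l2 (T f) \<and> (\<Sum>k. (cmod (T f k))\<^sup>2) \<le> K\<^sup>2 * (\<Sum>k. (cmod (f k))\<^sup>2)"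
  shows "op_norm T \<le> ereal K"
  unfolding op_norm_def
proof (rule SUP_least)
  fix f assume "f \<in> {f. is_l2 f \<and> l2norm f \<le> 1}"
  then have f: "is_l2 f" and "sqrt (\<Sum>k. (cmod (f k))\<^sup>2) \<le> 1" by (auto simp: l2norm_def)
  then have S: "(\<Sum>k. (cmod (f k))\<^sup>2) \<le> 1" by simp
  have "(\<Sum>k. (cmod (T f k))\<^sup>2) \<le> K\<^sup>2 * (\<Sum>k. (cmod (f k))\<^sup>2)" using T[OF f] by blast
  also have "\<dots> \<le> K\<^sup>2 * 1" by (intro mult_left_mono S) simp
  finally have "sqrt (\<Sum>k. (cmod (T f k))\<^sup>2) \<le> K" using K by (intro real_le_lsqrt) auto
  then show "l2norm (T f) \<le> ereal K" using T[OF f] by (simp add: l2norm_def)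
qed

lemma approx_num_nonneg: "0 \<le> approx_num m T"
  unfolding approx_num_def
proof (rule INF_greatest)
  fix P :: "(nat \<Rightarrow> complex) \<Rightarrow> nat \<Rightarrow> complex"
  have l2: "is_l2 (\<lambda>_. 0)" "l2norm (\<lambda>_. 0) \<le> 1" by (auto simp: is_l2_def l2norm_def)
  have "0 \<le> l2norm (\<lambda>k. T (\<lambda>_. 0) k - P (\<lambda>_. 0) k)"
    by (auto simp: l2norm_def is_l2_def intro!: suminf_nonneg)
  also have "\<dots> \<le> op_norm (\<lambda>f k. T f k - P f k)"
    unfolding op_norm_def using l2 by (intro SUP_upper2[of "\<lambda>_. 0"]) auto
  finally show "0 \<le> op_norm (\<lambda>f k. T f k - P f k)" .
qed

lemma approx_num_le:
  assumes "l2_linear P" "rank_le P n" "op_norm (\<lambda>f k. T f k - P f k) \<le> x"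
  shows "approx_num (Suc n) T \<le> x"
  unfolding approx_num_def by (rule INF_lower2[of P]) (use assms in auto)

lemma approx_num_le_op_norm: "approx_num (Suc n) T \<le> op_norm T"
proof (rule approx_num_le)
  show "l2_linear (\<lambda>f k. 0)" by (simp add: l2_linear_def)
  show "rank_le (\<lambda>f k. 0) n" unfolding rank_le_def
    by (intro exI[of _ "\<lambda>_ _. 0"] allI impI exI[of _ "\<lambda>_. 0"]) simp
qed simp

lemma l2_linear_rhaly: "l2_linear (rhaly \<alpha>)"
  unfolding l2_linear_def rhaly_def
proof (intro conjI allI impI ext)
  show "\<alpha> k * (\<Sum>j\<le>k. f j + g j) = \<alpha> k * (\<Sum>j\<le>k. f j) + \<alpha> k * (\<Sum>j\<le>k. g j)" for f g k
    by (simp only: sum.distrib distrib_left)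
  show "\<alpha> k * (\<Sum>j\<le>k. c * f j) = c * (\<alpha> k * (\<Sum>j\<le>k. f j))" for c f k
    by (simp only: sum_distrib_left[symmetric] mult.left_commute)
qed

text \<open>All rows with the same cut c k apply the same functional, the sum of the first c k
  entries, so each value in V accounts for one rank; rows with c k = 0 vanish.\<close>

lemma rank_le_truncated_rhaly:
  fixes c :: "nat \<Rightarrow> nat"
  assumes V: "finite V" "card V \<le> N" and c: "\<And>k. c k \<noteq> 0 \<Longrightarrow> c k \<in> V"
  shows "rank_le (\<lambda>f k. \<alpha> k * (\<Sum>j<c k. f j)) N"
proof -
  obtain e where e: "bij_betw e {0..<card V} V" using ex_bij_betw_nat_finite[OF V(1)] by blast
  \<comment> \<open>The vector v i is \<alpha> restricted to the level set c k = e i; it vanishes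
    for i \<ge> card V, which permits N to exceed card V.\<close>
  define v where "v = (\<lambda>i k. if i < card V \<and> c k = e i then \<alpha> k else 0)"
  have "\<alpha> k * (\<Sum>j<c k. f j) = (\<Sum>i<N. (\<Sum>j<e i. f j) * v i k)" for f and k
  proof (cases "c k \<in> V")
    case True
    then obtain i where i: "i < card V" "e i = c k" using e unfolding bij_betw_def by force
    have uniq: "i' = i" if "i' < card V" "c k = e i'" for i'
      using e i that unfolding bij_betw_def inj_on_def by auto
    have "(\<Sum>i<N. (\<Sum>j<e i. f j) * v i k) = (\<Sum>i\<in>{i}. (\<Sum>j<e i. f j) * v i k)"
    proof (rule sum.mono_neutral_right)
      show "\<forall>i'\<in>{..<N} - {i}. (\<Sum>j<e i'. f j) * v i' k = 0"
      proof
        fix i' assume "i' \<in> {..<N} - {i}"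
        then have "v i' k = 0" using uniq[of i'] by (auto simp: v_def)
        then show "(\<Sum>j<e i'. f j) * v i' k = 0" by simp
      qed
    qed (use i V in auto)
    also have "\<dots> = \<alpha> k * (\<Sum>j<c k. f j)" using i by (simp add: v_def mult.commute)
    finally show ?thesis by simp
  next
    case False
    then have "c k = 0" using c by blast
    have "v i k = 0" for i using False e by (auto simp: v_def bij_betw_def)
    then show ?thesis using \<open>c k = 0\<close> by simp
  qed
  then have "(\<lambda>k. \<alpha> k * (\<Sum>j<c k. f j)) = (\<lambda>k. \<Sum>i<N. (\<Sum>j<e i. f j) * v i k)" for f by auto
  then show ?thesis unfolding rank_le_def
    by (intro exI[of _ v] allI impI) (metis (no_types))
qed

text \<open>For k > 0 this is the integer part of log_2 k. It also sends 0 to 0 although 0 lies in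
  no block, so row 0 has to be separated from block 0 below.\<close>

definition dyadic_index :: "nat \<Rightarrow> nat" where
  "dyadic_index k = (LEAST n. k < 2 ^ (n + 1))"

lemma dyadic_index_eq:
  assumes "k \<in> {2 ^ n..<2 ^ (n + 1)}"
  shows "dyadic_index k = n"
  unfolding dyadic_index_def
proof (rule Least_equality)
  show "k < 2 ^ (n + 1)" using assms by simp
  fix m assume "k < 2 ^ (m + 1)"
  then have "(2::nat) ^ n < 2 ^ (m + 1)" using assms by (meson atLeastLessThan_iff le_less_trans)
  then show "n \<le> m" by (simp del: power_Suc add: power_strict_increasing_iff)
qed

lemma dyadic_index_mem:
  assumes "k \<noteq> 0"
  shows "k \<in> {2 ^ dyadic_index k..<2 ^ (dyadic_index k + 1)}"
proof -
  have ex: "\<exists>n. k < 2 ^ (n + 1)"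
    using less_trans[OF less_exp[of k], of "2 ^ (k + 1)"] by (intro exI[of _ k]) simp
  have 1: "k < 2 ^ (dyadic_index k + 1)" unfolding dyadic_index_def by (rule LeastI_ex[OF ex])
  have "2 ^ dyadic_index k \<le> k"
  proof (cases "dyadic_index k")
    case 0
    then show ?thesis using assms by simp
  next
    case (Suc m)
    then have "\<not> k < 2 ^ (m + 1)"
      using not_less_Least[of m "\<lambda>n. k < 2 ^ (n + 1)"] unfolding dyadic_index_def[symmetric] by auto
    then show ?thesis using Suc by simp
  qed
  with 1 show ?thesis by simp
qed

text \<open>The competitor P keeps the first d k columns of row k. Its error is controlled by
  \<open>greedy_partition\<close> in the blocks of G and by \<open>hardy_dyadic_bound\<close> in the
  other blocks, where d k = 0; its rank is at most the number of nonzero cut positions.\<close>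

lemma rhaly_approx_num_le:
  "\<exists>C\<ge>0. \<forall>\<alpha> l G N. 0 < l \<longrightarrow> finite G \<longrightarrow> (\<forall>n. n \<notin> G \<longrightarrow> dyadic_energy \<alpha> n \<le> l\<^sup>2) \<longrightarrow>
      1 + (\<Sum>n\<in>G. 2 * sqrt (dyadic_energy \<alpha> n) / l + 1) \<le> real N \<longrightarrow>
      approx_num (Suc N) (rhaly \<alpha>) \<le> ereal (C * l)"
proof -
  obtain C where C: "0 \<le> C" "\<forall>\<beta> l f. 0 \<le> l \<longrightarrow> cmod (\<beta> 0) \<le> l \<longrightarrow> (\<forall>n. dyadic_energy \<beta> n \<le> l\<^sup>2) \<longrightarrow>
      is_l2 f \<longrightarrow> is_l2 (rhaly \<beta> f) \<and>
           (\<Sum>k. (cmod (rhaly \<beta> f k))\<^sup>2) \<le> C * l\<^sup>2 * (\<Sum>k. (cmod (f k))\<^sup>2)"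
    using hardy_dyadic_bound by blast
  show ?thesis
  \<comment> \<open>In the squared error the blocks of G contribute l^2 and the remaining ones C
    l^2.\<close>
  proof (rule exI[of _ "sqrt (1 + C)"], intro conjI allI impI)
    show "0 \<le> sqrt (1 + C)" using C by simp
    fix \<alpha> :: "nat \<Rightarrow> complex" and l :: real and G :: "nat set" and N :: nat
    assume l: "0 < l" and G: "finite G" and small: "\<forall>n. n \<notin> G \<longrightarrow> dyadic_energy \<alpha> n \<le> l\<^sup>2"
      and N: "1 + (\<Sum>n\<in>G. 2 * sqrt (dyadic_energy \<alpha> n) / l + 1) \<le> real N"
    let ?I = "\<lambda>n. {2 ^ n..<2 ^ (n + 1)} :: nat set"
    have "\<forall>n. \<exists>c. real (card (c ` ?I n)) \<le> 2 * sqrt (dyadic_energy \<alpha> n) / l + 1 \<and>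
             (\<forall>k\<in>?I n. c k \<le> Suc k) \<and>
             (\<forall>f. (\<Sum>k\<in>?I n. (cmod (\<alpha> k * (\<Sum>j\<in>{c k..k}. f j)))\<^sup>2) \<le> l\<^sup>2 * (\<Sum>j\<in>?I n. (cmod (f j))\<^sup>2))"
    proof
      fix n
      show "\<exists>c. real (card (c ` ?I n)) \<le> 2 * sqrt (dyadic_energy \<alpha> n) / l + 1 \<and>
             (\<forall>k\<in>?I n. c k \<le> Suc k) \<and>
             (\<forall>f. (\<Sum>k\<in>?I n. (cmod (\<alpha> k * (\<Sum>j\<in>{c k..k}. f j)))\<^sup>2) \<le> l\<^sup>2 * (\<Sum>j\<in>?I n. (cmod (f j))\<^sup>2))"
        using greedy_partition[OF l, where \<alpha> = \<alpha> and a = "2 ^ n" and b = "2 ^ (n + 1)"]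
        unfolding interval_energy_dyadic .
    qed
    from choice[OF this] obtain c where c: "\<forall>n. real (card (c n ` ?I n)) \<le> 2 * sqrt (dyadic_energy \<alpha> n) / l + 1 \<and>
             (\<forall>k\<in>?I n. c n k \<le> Suc k) \<and>
             (\<forall>f. (\<Sum>k\<in>?I n. (cmod (\<alpha> k * (\<Sum>j\<in>{c n k..k}. f j)))\<^sup>2) \<le> l\<^sup>2 * (\<Sum>j\<in>?I n. (cmod (f j))\<^sup>2))"
      by (elim exE)
    note card_c = c[rule_format, THEN conjunct1]
    note c_le = c[rule_format, THEN conjunct2, THEN conjunct1, rule_format]
    note c_err = c[rule_format, THEN conjunct2, THEN conjunct2, rule_format]
    \<comment> \<open>Cutting row 0 after its only entry makes it exact, because no block energy
      controls \<alpha>(0); this is the summand 1 in the rank bound.\<close>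
    define d where "d = (\<lambda>k. if k = 0 then 1 else if dyadic_index k \<in> G then c (dyadic_index k) k else 0)"
    define V where "V = {1} \<union> (\<Union>n\<in>G. c n ` ?I n)"
    have "real (card V) \<le> 1 + (\<Sum>n\<in>G. real (card (c n ` ?I n)))"
    proof -
      have "card V \<le> card {1::nat} + card (\<Union>n\<in>G. c n ` ?I n)" unfolding V_def by (rule card_Un_le)
      also have "\<dots> \<le> 1 + (\<Sum>n\<in>G. card (c n ` ?I n))" using card_UN_le[OF G] by simp
      finally show ?thesis by (simp flip: of_nat_sum of_nat_Suc)
    qed
    also have "\<dots> \<le> 1 + (\<Sum>n\<in>G. 2 * sqrt (dyadic_energy \<alpha> n) / l + 1)"
      by (intro add_left_mono sum_mono card_c)
    finally have card_V: "card V \<le> N" using N by simp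
    have V: "finite V" using G by (simp add: V_def)
    have dV: "d k \<in> V" if "d k \<noteq> 0" for k
    proof (cases "k = 0")
      case False
      then have "dyadic_index k \<in> G" "d k = c (dyadic_index k) k"
        using that by (auto simp: d_def split: if_splits)
      then show ?thesis using dyadic_index_mem[OF False] unfolding V_def by blast
    qed (simp add: d_def V_def)
    have d_le: "d k \<le> Suc k" for k
      using dyadic_index_mem[of k] c_le[of k "dyadic_index k"] by (auto simp: d_def)
    define P where "P = (\<lambda>f k. \<alpha> k * (\<Sum>j<d k. f j))"
    \<comment> \<open>Only the rows other than row 0 outside the blocks of G are kept, so that all
      block energies of \<beta> are at most l^2 and the Hardy bound applies.\<close>
    define \<beta> where "\<beta> = (\<lambda>k. if k = 0 \<or> dyadic_index k \<in> G then 0 else \<alpha> k)"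
    have \<beta>: "dyadic_energy \<beta> n \<le> l\<^sup>2" for n
    proof (cases "n \<in> G")
      case True
      then have "dyadic_energy \<beta> n = 0"
        by (auto simp: dyadic_energy_def \<beta>_def dyadic_index_eq intro!: sum.neutral)
      then show ?thesis by simp
    next
      case False
      have "dyadic_energy \<beta> n = dyadic_energy \<alpha> n"
        unfolding dyadic_energy_def using False dyadic_index_eq[of _ n]
        by (intro arg_cong[where f = "\<lambda>x. 2 ^ n * x"] sum.cong) (auto simp: \<beta>_def)
      then show ?thesis using small False by simp
    qed
    have err: "rhaly \<alpha> f k - P f k = \<alpha> k * (\<Sum>j\<in>{d k..k}. f j)" for f k
    proof -
      have "(\<Sum>j\<le>k. f j) = (\<Sum>j\<in>{0..<Suc k}. f j)"
        by (simp only: atMost_atLeast0 atLeastLessThanSuc_atLeastAtMost)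
      also have "\<dots> = (\<Sum>j\<in>{0..<d k}. f j) + (\<Sum>j\<in>{d k..<Suc k}. f j)"
        using d_le[of k] by (intro sum.atLeastLessThan_concat[symmetric]) auto
      finally show ?thesis
        by (simp add: rhaly_def P_def distrib_left lessThan_atLeast0 atLeastLessThanSuc_atLeastAtMost)
    qed
    show "approx_num (Suc N) (rhaly \<alpha>) \<le> ereal (sqrt (1 + C) * l)"
    proof (rule approx_num_le[of P])
      show "l2_linear P"
        unfolding l2_linear_def P_def
      proof (intro conjI allI impI ext)
        show "\<alpha> k * (\<Sum>j<d k. f j + g j) = \<alpha> k * (\<Sum>j<d k. f j) + \<alpha> k * (\<Sum>j<d k. g j)" for f g k
          by (simp only: sum.distrib distrib_left)
        show "\<alpha> k * (\<Sum>j<d k. c * f j) = c * (\<alpha> k * (\<Sum>j<d k. f j))" for c f k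
          by (simp only: sum_distrib_left[symmetric] mult.left_commute)
      qed
      show "rank_le P N"
        unfolding P_def using dV by (rule rank_le_truncated_rhaly[OF V card_V])
      show "op_norm (\<lambda>f k. rhaly \<alpha> f k - P f k) \<le> ereal (sqrt (1 + C) * l)"
      proof (rule op_norm_le)
        show "0 \<le> sqrt (1 + C) * l" using C l by simp
        fix f assume f: "is_l2 f"
        define S where "S = (\<Sum>k. (cmod (f k))\<^sup>2)"
        have part: "(\<Sum>k\<in>A. (cmod (f k))\<^sup>2) \<le> S" if "finite A" for A
          unfolding S_def using f that by (intro sum_le_suminf) (auto simp: is_l2_def)
        have R\<beta>: "is_l2 (rhaly \<beta> f)" "(\<Sum>k. (cmod (rhaly \<beta> f k))\<^sup>2) \<le> C * l\<^sup>2 * S"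
          using C(2)[rule_format, of l \<beta> f] l \<beta> f by (auto simp: S_def \<beta>_def)
        have R\<beta>part: "(\<Sum>k\<in>A. (cmod (rhaly \<beta> f k))\<^sup>2) \<le> C * l\<^sup>2 * S" if "finite A" for A
        proof -
          have "(\<Sum>k\<in>A. (cmod (rhaly \<beta> f k))\<^sup>2) \<le> (\<Sum>k. (cmod (rhaly \<beta> f k))\<^sup>2)"
            using R\<beta>(1) that by (intro sum_le_suminf) (auto simp: is_l2_def)
          then show ?thesis using R\<beta>(2) by simp
        qed
        let ?e = "\<lambda>k. (cmod (\<alpha> k * (\<Sum>j\<in>{d k..k}. f j)))\<^sup>2"
        have block: "(\<Sum>k\<in>?I n. ?e k) \<le> l\<^sup>2 * (\<Sum>j\<in>?I n. (cmod (f j))\<^sup>2) + (\<Sum>k\<in>?I n. (cmod (rhaly \<beta> f k))\<^sup>2)" for n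
        proof (cases "n \<in> G")
          case True
          then have "(\<Sum>k\<in>?I n. ?e k) = (\<Sum>k\<in>?I n. (cmod (\<alpha> k * (\<Sum>j\<in>{c n k..k}. f j)))\<^sup>2)"
            using dyadic_index_eq[of _ n] by (intro sum.cong) (auto simp: d_def)
          also have "\<dots> \<le> l\<^sup>2 * (\<Sum>j\<in>?I n. (cmod (f j))\<^sup>2)" by (rule c_err)
          finally show ?thesis by (simp add: sum_nonneg add_increasing2)
        next
          case False
          then have "(\<Sum>k\<in>?I n. ?e k) = (\<Sum>k\<in>?I n. (cmod (rhaly \<beta> f k))\<^sup>2)"
            using dyadic_index_eq[of _ n] by (intro sum.cong) (auto simp: d_def \<beta>_def rhaly_def atMost_atLeast0)
          then show ?thesis by (simp add: sum_nonneg)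
        qed
        have bound: "(\<Sum>k<M. ?e k) \<le> (sqrt (1 + C) * l)\<^sup>2 * S" for M
        proof -
          have "(\<Sum>k<M. ?e k) \<le> (\<Sum>k\<in>{0} \<union> {1..<2 ^ M}. ?e k)"
            using less_trans[OF _ less_exp[of M]] by (intro sum_mono2) auto
          also have "\<dots> = (\<Sum>k\<in>{1..<2 ^ M}. ?e k)"
            by (subst sum.union_disjoint) (auto simp: d_def)
          also have "\<dots> = (\<Sum>n<M. \<Sum>k\<in>?I n. ?e k)" by (rule sum_dyadic_blocks)
          also have "\<dots> \<le> (\<Sum>n<M. l\<^sup>2 * (\<Sum>j\<in>?I n. (cmod (f j))\<^sup>2) + (\<Sum>k\<in>?I n. (cmod (rhaly \<beta> f k))\<^sup>2))"
            by (intro sum_mono block)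
          also have "\<dots> = l\<^sup>2 * (\<Sum>k\<in>{1..<2 ^ M}. (cmod (f k))\<^sup>2) + (\<Sum>k\<in>{1..<2 ^ M}. (cmod (rhaly \<beta> f k))\<^sup>2)"
            by (simp only: sum_dyadic_blocks sum.distrib sum_distrib_left)
          also have "\<dots> \<le> l\<^sup>2 * S + C * l\<^sup>2 * S"
            by (intro add_mono mult_left_mono part R\<beta>part) auto
          also have "\<dots> = (sqrt (1 + C) * l)\<^sup>2 * S" using C by (simp add: power_mult_distrib algebra_simps)
          finally show ?thesis .
        qed
        have s: "summable ?e" by (rule summableI_nonneg_bounded[OF _ bound]) simp
        show "is_l2 (\<lambda>k. rhaly \<alpha> f k - P f k) \<and>
            (\<Sum>k. (cmod (rhaly \<alpha> f k - P f k))\<^sup>2) \<le> (sqrt (1 + C) * l)\<^sup>2 * (\<Sum>k. (cmod (f k))\<^sup>2)"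
          unfolding err is_l2_def S_def[symmetric] using s suminf_le_const[OF s bound] by blast
      qed
    qed
  qed
qed

section \<open>From a counting bound to summability of powers\<close>

lemma summable_finite_gt:
  fixes g :: "nat \<Rightarrow> real"
  assumes "summable g" "0 < e"
  shows "finite {n. e < g n}"
proof -
  have "eventually (\<lambda>n. g n < e) sequentially"
    using summable_LIMSEQ_zero[OF assms(1)] assms(2) by (rule order_tendstoD)
  then obtain N where "\<And>n. N \<le> n \<Longrightarrow> g n < e" by (auto simp: eventually_sequentially)
  then have "{n. e < g n} \<subseteq> {..<N}" by (force simp: not_less[symmetric])
  then show ?thesis using finite_subset by blast
qed

text \<open>The sum starts at the least j with 2^(-j) < s; there \<tau>^j = (2^(-j))^\<delta> is at
  most s^\<delta>, and the remaining geometric series gives 1/(1 - \<tau>).\<close>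

lemma geometric_tail_below:
  fixes s \<delta> :: real
  assumes s: "0 \<le> s" and \<delta>: "0 < \<delta>"
  defines "\<tau> \<equiv> (1/2) powr \<delta>"
  shows "summable (\<lambda>j. \<tau> ^ j * of_bool ((1/2) ^ j < s))"
    and "(\<Sum>j. \<tau> ^ j * of_bool ((1/2) ^ j < s)) \<le> s powr \<delta> / (1 - \<tau>)"
proof -
  let ?g = "\<lambda>j::nat. \<tau> ^ j * of_bool ((1/2) ^ j < s)"
  have \<tau>: "0 < \<tau>" "\<tau> < 1" using \<delta> powr_less_mono2[of \<delta> "1/2" 1] by (auto simp: \<tau>_def)
  have geo: "summable (\<lambda>j. \<tau> ^ j)" using \<tau> by (intro summable_geometric) auto
  show sg: "summable ?g"
    by (rule summable_comparison_test'[OF geo, of 0]) (use \<tau> in auto)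
  show "suminf ?g \<le> s powr \<delta> / (1 - \<tau>)"
  proof (cases "\<exists>j::nat. (1/2) ^ j < s")
    case True
    define i where "i = (LEAST j::nat. (1/2) ^ j < s)"
    have i: "(1/2) ^ i < s" unfolding i_def by (rule LeastI_ex[OF True])
    have 0: "?g j = 0" if "j < i" for j
      using not_less_Least[of j "\<lambda>j. (1/2) ^ j < s"] that unfolding i_def[symmetric] by auto
    have "suminf ?g = (\<Sum>j. ?g (j + i)) + (\<Sum>j<i. ?g j)"
      by (rule suminf_split_initial_segment[OF sg])
    also have "(\<Sum>j<i. ?g j) = 0" by (intro sum.neutral) (use 0 in auto)
    also have "(\<Sum>j. ?g (j + i)) + 0 \<le> (\<Sum>j. \<tau> ^ i * \<tau> ^ j)"
      unfolding add_0_right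
    proof (rule suminf_le)
      show "?g (j + i) \<le> \<tau> ^ i * \<tau> ^ j" for j using \<tau> by (simp add: power_add)
      show "summable (\<lambda>j. ?g (j + i))" using sg by (rule summable_ignore_initial_segment)
      show "summable (\<lambda>j. \<tau> ^ i * \<tau> ^ j)" using geo by (rule summable_mult)
    qed
    also have "\<dots> = \<tau> ^ i * (\<Sum>j. \<tau> ^ j)" by (rule suminf_mult[OF geo])
    also have "\<dots> = \<tau> ^ i / (1 - \<tau>)" using \<tau> by (simp add: suminf_geometric)
    also have "\<tau> ^ i = ((1/2) ^ i) powr \<delta>"
      by (simp add: \<tau>_def powr_realpow[symmetric] powr_powr mult.commute)
    also have "\<dots> / (1 - \<tau>) \<le> s powr \<delta> / (1 - \<tau>)"
      using i \<delta> \<tau> by (intro divide_right_mono powr_mono2) auto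
    finally show ?thesis .
  next
    case False
    then show ?thesis using \<tau> by simp
  qed
qed

text \<open>Layer cake: \<open>\<Sum> a\<^sub>k\<^sup>q\<close> is bounded by \<open>\<Sum>\<^sub>j 2\<^sup>-\<^sup>j\<^sup>q\<close> times the number of \<open>k\<close> with
  \<open>a\<^sub>k > K 2\<^sup>-\<^sup>j\<close>; interchanging the sums over \<open>j\<close> and \<open>n\<close> leaves a geometric series in
  \<open>j\<close> with ratio \<open>2\<^sup>1\<^sup>-\<^sup>q\<close>, which is where \<open>q > 1\<close> enters.\<close>

lemma summable_powr_of_counting_bound:
  fixes a s :: "nat \<Rightarrow> real"
  assumes q: "1 < q" and K: "0 < K" and a: "\<And>k. 0 \<le> a k" "\<And>k. a k \<le> K"
    and s: "\<And>n. 0 \<le> s n" "summable (\<lambda>n. s n powr q)"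
    and count: "\<And>j k. 1 + (\<Sum>n | (1/2) ^ j < s n. 3 * s n * 2 ^ j) \<le> real k \<Longrightarrow> a k \<le> K * (1/2) ^ j"
  shows "summable (\<lambda>k. a k powr q)"
proof -
  define X where "X = (\<lambda>j. \<Sum>n | (1/2) ^ j < s n. 3 * s n * 2 ^ j)"
  \<comment> \<open>The ratio of consecutive layer heights, raised to q, is \<sigma>; the factor 2^j
    in the counting bound turns it into \<tau> = 2\<sigma> = 2^(1-q).\<close>
  define \<sigma> where "\<sigma> = (1/2::real) powr q"
  define \<tau> where "\<tau> = (1/2::real) powr (q - 1)"
  have \<sigma>: "0 < \<sigma>" "\<sigma> < 1" using q powr_less_mono2[of q "1/2" 1] by (auto simp: \<sigma>_def)
  have \<tau>: "0 < \<tau>" "\<tau> < 1" using q powr_less_mono2[of "q - 1" "1/2" 1] by (auto simp: \<tau>_def)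
  have \<sigma>\<tau>: "\<sigma> ^ j * 2 ^ j = \<tau> ^ j" for j
  proof -
    have "\<sigma> * 2 = \<tau>" by (simp add: \<sigma>_def \<tau>_def powr_diff)
    then show ?thesis by (simp only: power_mult_distrib[symmetric])
  qed
  have X0: "0 \<le> X j" for j unfolding X_def using s by (intro sum_nonneg) auto
  have fin: "finite {n. (1/2) ^ j < s n}" for j :: nat
  proof -
    have "finite {n. ((1/2) ^ j) powr q < s n powr q}"
      by (rule summable_finite_gt[OF s(2)]) simp
    moreover have "{n. (1/2) ^ j < s n} \<subseteq> {n. ((1/2) ^ j) powr q < s n powr q}"
      using q by (auto intro!: powr_less_mono2)
    ultimately show ?thesis using finite_subset by blast
  qed
  have pointwise: "ennreal (a k powr q)
      \<le> (\<Sum>j. ennreal ((2 * K) powr q) * (ennreal (\<sigma> ^ j) * indicator {k. K * (1/2) ^ j < a k} k))" for k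
  proof (cases "a k = 0")
    case False
    then have ak: "0 < a k" using a(1)[of k] by simp
    have ex: "\<exists>j. K * (1/2) ^ j < a k"
    proof -
      obtain j where "(1/2) ^ j < a k / K" using real_arch_pow_inv[of "a k / K" "1/2"] ak K by auto
      then show ?thesis using K by (intro exI[of _ j]) (simp add: field_simps)
    qed
    \<comment> \<open>At the first layer below a k the value is at most twice that layer: the
      preceding layer is not below it, and for j = 0 the global bound \<open>a k \<le> K\<close> is
      used.\<close>
    define j where "j = (LEAST j. K * (1/2) ^ j < a k)"
    have j: "K * (1/2) ^ j < a k" unfolding j_def by (rule LeastI_ex[OF ex])
    have "a k \<le> 2 * K * (1/2) ^ j"
    proof (cases j)
      case 0
      then show ?thesis using a(2)[of k] K by simp
    next
      case (Suc i)
      then have "\<not> K * (1/2) ^ i < a k"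
        using not_less_Least[of i "\<lambda>j. K * (1/2) ^ j < a k"] unfolding j_def[symmetric] by auto
      then show ?thesis using Suc by simp
    qed
    then have "a k powr q \<le> (2 * K * (1/2) ^ j) powr q"
      using ak q by (intro powr_mono2) auto
    also have "\<dots> = (2 * K) powr q * \<sigma> ^ j"
      using K by (simp add: powr_mult \<sigma>_def powr_realpow[symmetric] powr_powr mult.commute)
    finally have "ennreal (a k powr q) \<le> ennreal ((2 * K) powr q) * ennreal (\<sigma> ^ j)"
      by (simp add: ennreal_leI flip: ennreal_mult')
    also have "\<dots> = (\<Sum>i\<in>{j}. ennreal ((2 * K) powr q) * (ennreal (\<sigma> ^ i) * indicator {k. K * (1/2) ^ i < a k} k))"
      using j by simp
    also have "\<dots> \<le> (\<Sum>j. ennreal ((2 * K) powr q) * (ennreal (\<sigma> ^ j) * indicator {k. K * (1/2) ^ j < a k} k))"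
      by (rule sum_le_suminf) auto
    finally show ?thesis .
  qed simp
  have counting: "(\<Sum>k. indicator {k. K * (1/2) ^ j < a k} k) \<le> ennreal (2 + X j)" for j
  proof -
    \<comment> \<open>From index m on the values do not exceed the layer, by \<open>count\<close>;
      rounding up costs at most 1, so 1 + X j becomes 2 + X j.\<close>
    define m where "m = nat \<lceil>1 + X j\<rceil>"
    have zero: "indicator {k. K * (1/2) ^ j < a k} k = (0::ennreal)" if "k \<notin> {..<m}" for k
    proof -
      have "1 + X j \<le> real k" using that by (simp add: m_def not_less)
      then have "a k \<le> K * (1/2) ^ j" unfolding X_def by (rule count)
      then show ?thesis by simp
    qed
    have "(\<Sum>k. indicator {k. K * (1/2) ^ j < a k} k) = (\<Sum>k<m. indicator {k. K * (1/2) ^ j < a k} k :: ennreal)"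
      by (rule suminf_finite) (use zero in auto)
    also have "\<dots> \<le> (\<Sum>k<m. 1)" by (intro sum_mono) (auto simp: indicator_def)
    also have "\<dots> = ennreal (real m)" by (simp add: ennreal_of_nat_eq_real_of_nat)
    also have "\<dots> \<le> ennreal (2 + X j)" using X0[of j] by (intro ennreal_leI) (simp add: m_def, linarith)
    finally show ?thesis .
  qed
  have Xsum: "(\<Sum>j. ennreal (\<sigma> ^ j * X j)) \<le> (\<Sum>n. ennreal (3 / (1 - \<tau>) * s n powr q))"
  proof -
    have "(\<Sum>j. ennreal (\<sigma> ^ j * X j)) = (\<Sum>j. \<Sum>n. ennreal (3 * s n * (\<tau> ^ j * of_bool ((1/2) ^ j < s n))))"
    proof (rule suminf_cong)
      fix j
      have "(\<Sum>n. ennreal (3 * s n * (\<tau> ^ j * of_bool ((1/2) ^ j < s n))))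
          = (\<Sum>n | (1/2) ^ j < s n. ennreal (3 * s n * (\<tau> ^ j * of_bool ((1/2) ^ j < s n))))"
        by (rule suminf_finite[OF fin]) auto
      also have "\<dots> = (\<Sum>n | (1/2) ^ j < s n. ennreal (\<sigma> ^ j * (3 * s n * 2 ^ j)))"
        by (intro sum.cong refl arg_cong[where f = ennreal]) (simp add: \<sigma>\<tau>[symmetric])
      also have "\<dots> = ennreal (\<sigma> ^ j * X j)"
        unfolding X_def sum_distrib_left using s \<sigma> by (intro sum_ennreal) auto
      finally show "ennreal (\<sigma> ^ j * X j) = (\<Sum>n. ennreal (3 * s n * (\<tau> ^ j * of_bool ((1/2) ^ j < s n))))"
        by (rule sym)
    qed
    also have "\<dots> = (\<Sum>n. \<Sum>j. ennreal (3 * s n * (\<tau> ^ j * of_bool ((1/2) ^ j < s n))))"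
      by (rule suminf_ennreal_swap)
    also have "\<dots> \<le> (\<Sum>n. ennreal (3 / (1 - \<tau>) * s n powr q))"
    proof (intro suminf_le)
      fix n
      \<comment> \<open>With exponent q - 1 > 0 the sum over j is at most a multiple of s^(q-1), and
        the prefactor s restores s^q.\<close>
      note tail = geometric_tail_below[OF s(1)[of n], of "q - 1", folded \<tau>_def]
      have "(\<Sum>j. ennreal (3 * s n * (\<tau> ^ j * of_bool ((1/2) ^ j < s n))))
          = ennreal (\<Sum>j. 3 * s n * (\<tau> ^ j * of_bool ((1/2) ^ j < s n)))"
        using tail(1) q s \<tau> by (intro suminf_ennreal2 summable_mult) auto
      also have "(\<Sum>j. 3 * s n * (\<tau> ^ j * of_bool ((1/2) ^ j < s n)))
          = 3 * s n * (\<Sum>j. \<tau> ^ j * of_bool ((1/2) ^ j < s n))"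
        using tail(1) q by (intro suminf_mult) auto
      also have "ennreal \<dots> \<le> ennreal (3 * s n * (s n powr (q - 1) / (1 - \<tau>)))"
        using tail(2) q s by (intro ennreal_leI mult_left_mono) auto
      also have "3 * s n * (s n powr (q - 1) / (1 - \<tau>)) = 3 / (1 - \<tau>) * s n powr q"
        using s(1)[of n] by (cases "s n = 0") (auto simp: powr_diff)
      finally show "(\<Sum>j. ennreal (3 * s n * (\<tau> ^ j * of_bool ((1/2) ^ j < s n))))
          \<le> ennreal (3 / (1 - \<tau>) * s n powr q)" .
    qed auto
    finally show ?thesis .
  qed
  have "(\<Sum>k. ennreal (a k powr q))
      \<le> (\<Sum>k. \<Sum>j. ennreal ((2 * K) powr q) * (ennreal (\<sigma> ^ j) * indicator {k. K * (1/2) ^ j < a k} k))"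
    by (intro suminf_le pointwise) auto
  also have "\<dots> = ennreal ((2 * K) powr q) * (\<Sum>k. \<Sum>j. ennreal (\<sigma> ^ j) * indicator {k. K * (1/2) ^ j < a k} k)"
    by (simp only: ennreal_suminf_cmult)
  also have "(\<Sum>k. \<Sum>j. ennreal (\<sigma> ^ j) * indicator {k. K * (1/2) ^ j < a k} k)
      = (\<Sum>j. \<Sum>k. ennreal (\<sigma> ^ j) * indicator {k. K * (1/2) ^ j < a k} k)"
    by (rule suminf_ennreal_swap)
  finally have 1: "(\<Sum>k. ennreal (a k powr q))
      \<le> ennreal ((2 * K) powr q) * (\<Sum>j. \<Sum>k. ennreal (\<sigma> ^ j) * indicator {k. K * (1/2) ^ j < a k} k)" .
  have "(\<Sum>j. \<Sum>k. ennreal (\<sigma> ^ j) * indicator {k. K * (1/2) ^ j < a k} k)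
      \<le> (\<Sum>j. ennreal (2 * \<sigma> ^ j) + ennreal (\<sigma> ^ j * X j))"
  proof (rule suminf_le)
    fix j
    have "(\<Sum>k. ennreal (\<sigma> ^ j) * indicator {k. K * (1/2) ^ j < a k} k) \<le> ennreal (\<sigma> ^ j) * ennreal (2 + X j)"
      unfolding ennreal_suminf_cmult by (intro mult_left_mono counting) simp
    also have "\<dots> = ennreal (2 * \<sigma> ^ j + \<sigma> ^ j * X j)"
      using \<sigma> by (subst ennreal_mult'[symmetric]) (simp_all only: distrib_left mult.commute zero_le_power less_imp_le)
    also have "\<dots> = ennreal (2 * \<sigma> ^ j) + ennreal (\<sigma> ^ j * X j)"
      using \<sigma> X0[of j] by (intro ennreal_plus) auto
    finally show "(\<Sum>k. ennreal (\<sigma> ^ j) * indicator {k. K * (1/2) ^ j < a k} k)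
        \<le> ennreal (2 * \<sigma> ^ j) + ennreal (\<sigma> ^ j * X j)" .
  qed auto
  also have "\<dots> = (\<Sum>j. ennreal (2 * \<sigma> ^ j)) + (\<Sum>j. ennreal (\<sigma> ^ j * X j))"
    by (rule suminf_add[symmetric]) auto
  also have "\<dots> \<le> (\<Sum>j. ennreal (2 * \<sigma> ^ j)) + (\<Sum>n. ennreal (3 / (1 - \<tau>) * s n powr q))"
    by (intro add_left_mono Xsum)
  also have "\<dots> < \<infinity>"
  proof -
    have "(\<Sum>j. ennreal (2 * \<sigma> ^ j)) \<noteq> top"
      using \<sigma> by (intro ennreal_suminf_neq_top summable_mult summable_geometric) auto
    moreover have "(\<Sum>n. ennreal (3 / (1 - \<tau>) * s n powr q)) \<noteq> top"
      using \<tau> s by (intro ennreal_suminf_neq_top summable_mult) auto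
    ultimately show ?thesis by (simp add: less_top)
  qed
  finally have "ennreal ((2 * K) powr q) * (\<Sum>j. \<Sum>k. ennreal (\<sigma> ^ j) * indicator {k. K * (1/2) ^ j < a k} k) < \<infinity>"
    by (simp add: ennreal_mult_less_top)
  with 1 have "(\<Sum>k. ennreal (a k powr q)) \<noteq> top" by (auto simp: top_unique)
  then show ?thesis by (intro summable_suminf_not_top) auto
qed

lemma real_of_ereal_between:
  assumes "0 \<le> x" "x \<le> ereal y"
  shows "real_of_ereal x \<le> y"
  using assms by (cases x) auto

text \<open>A common bound for the block energies gives boundedness through
  \<open>hardy_dyadic_bound\<close>. Then \<open>rhaly_approx_num_le\<close>, with l = 2^(-j) and G
  the blocks where s exceeds l, supplies the counting hypothesis of
  \<open>summable_powr_of_counting_bound\<close>.\<close>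

theorem schatten_rhaly_if_dyadic_summable:
  assumes q: "1 < q" and summ: "summable (\<lambda>n. dyadic_energy \<alpha> n powr (q / 2))"
  shows "schatten q (rhaly \<alpha>)"
proof -
  define s where "s = (\<lambda>n. sqrt (dyadic_energy \<alpha> n))"
  have s0: "0 \<le> s n" for n by (simp add: s_def)
  have s2: "dyadic_energy \<alpha> n = (s n)\<^sup>2" for n by (simp add: s_def)
  have "s n powr q = dyadic_energy \<alpha> n powr (q / 2)" for n
    by (simp add: s_def powr_half_sqrt[symmetric] powr_powr)
  then have ss: "summable (\<lambda>n. s n powr q)" using summ by simp
  have fin: "finite {n. x < s n}" if "0 < x" for x
  proof -
    have "finite {n. x powr q < s n powr q}"
      by (rule summable_finite_gt[OF ss]) (use that in simp)
    moreover have "{n. x < s n} \<subseteq> {n. x powr q < s n powr q}"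
      using q that by (auto intro!: powr_less_mono2)
    ultimately show ?thesis using finite_subset by blast
  qed
  obtain C where C: "0 \<le> C" "\<forall>\<beta> l f. 0 \<le> l \<longrightarrow> cmod (\<beta> 0) \<le> l \<longrightarrow> (\<forall>n. dyadic_energy \<beta> n \<le> l\<^sup>2) \<longrightarrow>
      is_l2 f \<longrightarrow> is_l2 (rhaly \<beta> f) \<and>
           (\<Sum>k. (cmod (rhaly \<beta> f k))\<^sup>2) \<le> C * l\<^sup>2 * (\<Sum>k. (cmod (f k))\<^sup>2)"
    using hardy_dyadic_bound by blast
  \<comment> \<open>Only finitely many s n exceed 1, so their sum together with 1 dominates every s
    n; |\<alpha>(0)| is added for row 0.\<close>
  define L where "L = 1 + cmod (\<alpha> 0) + (\<Sum>n | 1 < s n. s n)"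
  have sum0: "0 \<le> (\<Sum>n | 1 < s n. s n)" using s0 by (intro sum_nonneg)
  have sL: "s n \<le> L" for n
  proof (cases "1 < s n")
    case True
    then have "s n \<le> (\<Sum>n | 1 < s n. s n)"
      using fin[of 1] s0 by (intro member_le_sum) auto
    then show ?thesis unfolding L_def using norm_ge_zero[of "\<alpha> 0"] by linarith
  next
    case False
    then show ?thesis unfolding L_def using norm_ge_zero[of "\<alpha> 0"] sum0 by linarith
  qed
  have L: "0 \<le> L" "cmod (\<alpha> 0) \<le> L" "\<forall>n. dyadic_energy \<alpha> n \<le> L\<^sup>2"
    using sum0 sL s0 by (auto simp: L_def s2 intro!: power_mono)
  have bounded: "is_l2 (rhaly \<alpha> f)" "(\<Sum>k. (cmod (rhaly \<alpha> f k))\<^sup>2) \<le> C * L\<^sup>2 * (\<Sum>k. (cmod (f k))\<^sup>2)"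
    if "is_l2 f" for f
    using C(2)[rule_format, of L \<alpha> f] L that by auto
  define K where "K = sqrt C * L"
  have K0: "0 \<le> K" using C L by (simp add: K_def)
  have norm: "op_norm (rhaly \<alpha>) \<le> ereal K"
    by (rule op_norm_le[OF K0]) (use bounded C in \<open>auto simp: K_def power_mult_distrib\<close>)
  then have "op_norm (rhaly \<alpha>) < \<infinity>" by (rule le_less_trans) simp
  then have "bounded_l2_op (rhaly \<alpha>)"
    using l2_linear_rhaly bounded(1) by (auto simp: bounded_l2_op_def)
  moreover obtain D where D: "0 \<le> D" "\<forall>\<alpha> l G N. 0 < l \<longrightarrow> finite G \<longrightarrow> (\<forall>n. n \<notin> G \<longrightarrow> dyadic_energy \<alpha> n \<le> l\<^sup>2) \<longrightarrow>
      1 + (\<Sum>n\<in>G. 2 * sqrt (dyadic_energy \<alpha> n) / l + 1) \<le> real N \<longrightarrow>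
      approx_num (Suc N) (rhaly \<alpha>) \<le> ereal (D * l)"
    using rhaly_approx_num_le by blast
  have "summable (\<lambda>k. real_of_ereal (approx_num (Suc k) (rhaly \<alpha>)) powr q)"
  proof (rule summable_powr_of_counting_bound[OF q, where K = "1 + K + D" and s = s])
    show "0 < 1 + K + D" using K0 D by simp
    show "0 \<le> real_of_ereal (approx_num (Suc k) (rhaly \<alpha>))" for k
      by (intro real_of_ereal_pos approx_num_nonneg)
    have "real_of_ereal (approx_num (Suc k) (rhaly \<alpha>)) \<le> K" for k
      by (intro real_of_ereal_between approx_num_nonneg order_trans[OF approx_num_le_op_norm norm])
    then show "real_of_ereal (approx_num (Suc k) (rhaly \<alpha>)) \<le> 1 + K + D" for k
      using D(1) by (smt (verit))
    show "0 \<le> s n" for n by (rule s0)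
    show "summable (\<lambda>n. s n powr q)" by (rule ss)
    fix j k :: nat
    assume k: "1 + (\<Sum>n | (1/2) ^ j < s n. 3 * s n * 2 ^ j) \<le> real k"
    let ?G = "{n. (1/2) ^ j < s n}"
    have "approx_num (Suc k) (rhaly \<alpha>) \<le> ereal (D * (1/2) ^ j)"
    proof (rule D(2)[rule_format, of _ ?G])
      show "(0::real) < (1/2) ^ j" by simp
      then show "finite ?G" by (rule fin)
      show "dyadic_energy \<alpha> n \<le> ((1/2) ^ j)\<^sup>2" if "n \<notin> ?G" for n
        unfolding s2 using that s0 by (intro power_mono) auto
      have "(\<Sum>n\<in>?G. 2 * sqrt (dyadic_energy \<alpha> n) / (1/2) ^ j + 1) \<le> (\<Sum>n\<in>?G. 3 * s n * 2 ^ j)"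
      proof (rule sum_mono)
        fix n assume "n \<in> ?G"
        \<comment> \<open>For blocks in G the summand 1 is absorbed by s n * 2^j, which turns the
          coefficient 2 into 3.\<close>
        then have "1 \<le> s n * 2 ^ j" by (simp add: field_simps power_divide)
        then show "2 * sqrt (dyadic_energy \<alpha> n) / (1/2) ^ j + 1 \<le> 3 * s n * 2 ^ j"
          by (simp add: s_def power_divide)
      qed
      then show "1 + (\<Sum>n\<in>?G. 2 * sqrt (dyadic_energy \<alpha> n) / (1/2) ^ j + 1) \<le> real k"
        using k by linarith
    qed
    then have "real_of_ereal (approx_num (Suc k) (rhaly \<alpha>)) \<le> D * (1/2) ^ j"
      by (intro real_of_ereal_between approx_num_nonneg)
    also have "\<dots> \<le> (1 + K + D) * (1/2) ^ j" using K0 by (intro mult_right_mono) auto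
    finally show "real_of_ereal (approx_num (Suc k) (rhaly \<alpha>)) \<le> (1 + K + D) * (1/2) ^ j" .
  qed
  ultimately show ?thesis by (simp add: schatten_def)
qed

section \<open>Lower bounds for approximation numbers\<close>

text \<open>Gaussian elimination by induction on the number of equations: a pivot n0 in the last
  equation eliminates one unknown, whose value is recovered from a solution of the smaller system.
  Without a pivot the last equation holds trivially.\<close>

lemma homogeneous_system_nontrivial:
  fixes A :: "'i \<Rightarrow> nat \<Rightarrow> 'a::field"
  assumes "finite M" "m < card M"
  shows "\<exists>c. (\<exists>n\<in>M. c n \<noteq> 0) \<and> (\<forall>i<m. (\<Sum>n\<in>M. c n * A n i) = 0)"
  using assms
proof (induction m arbitrary: M A)
  case 0
  then have "M \<noteq> {}" by auto
  then show ?case by (intro exI[of _ "\<lambda>_. 1"]) auto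
next
  case (Suc m)
  show ?case
  proof (cases "\<forall>n\<in>M. A n m = 0")
    case True
    obtain c where "\<exists>n\<in>M. c n \<noteq> 0" "\<forall>i<m. (\<Sum>n\<in>M. c n * A n i) = 0"
      using Suc.IH[of M A] Suc.prems by auto
    then show ?thesis using True by (intro exI[of _ c]) (auto simp: less_Suc_eq)
  next
    case False
    then obtain n0 where n0: "n0 \<in> M" "A n0 m \<noteq> 0" by blast
    define B where "B = (\<lambda>n i. A n i - A n m / A n0 m * A n0 i)"
    have "m < card (M - {n0})" "finite (M - {n0})" using Suc.prems n0 by auto
    then obtain c where c: "\<exists>n\<in>M - {n0}. c n \<noteq> 0" "\<forall>i<m. (\<Sum>n\<in>M - {n0}. c n * B n i) = 0"
      using Suc.IH[of "M - {n0}" B] by blast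
    define d where "d = c(n0 := - (\<Sum>n\<in>M - {n0}. c n * (A n m / A n0 m)))"
    have eq: "(\<Sum>n\<in>M. d n * A n i) = (\<Sum>n\<in>M - {n0}. c n * B n i)" for i
    proof -
      have "(\<Sum>n\<in>M. d n * A n i) = d n0 * A n0 i + (\<Sum>n\<in>M - {n0}. d n * A n i)"
        using Suc.prems n0 by (intro sum.remove) auto
      also have "(\<Sum>n\<in>M - {n0}. d n * A n i) = (\<Sum>n\<in>M - {n0}. c n * A n i)"
        by (intro sum.cong) (auto simp: d_def)
      also have "d n0 * A n0 i + (\<Sum>n\<in>M - {n0}. c n * A n i) = (\<Sum>n\<in>M - {n0}. c n * B n i)"
        by (simp add: d_def B_def right_diff_distrib sum_subtractf sum_distrib_right mult.assoc)
      finally show ?thesis .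
    qed
    have "B n m = 0" for n using n0 by (simp add: B_def)
    then have "\<forall>i<Suc m. (\<Sum>n\<in>M. d n * A n i) = 0" using c(2) eq by (auto simp: less_Suc_eq)
    moreover have "\<exists>n\<in>M. d n \<noteq> 0" using c(1) by (auto simp: d_def)
    ultimately show ?thesis by blast
  qed
qed

section \<open>Linear combinations in l2 and lower estimates of operator norms\<close>

lemma is_l2_zero [simp]: "is_l2 (\<lambda>_. 0)"
  by (simp add: is_l2_def)

lemma is_l2_finite_support:
  assumes "finite A" "\<And>k. k \<notin> A \<Longrightarrow> f k = 0"
  shows "is_l2 f" "(\<Sum>k. (cmod (f k))\<^sup>2) = (\<Sum>k\<in>A. (cmod (f k))\<^sup>2)"
  unfolding is_l2_def using assms
  by (auto intro!: summable_finite[of A] suminf_finite)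

lemma is_l2_add:
  assumes "is_l2 f" "is_l2 g"
  shows "is_l2 (\<lambda>k. f k + g k)"
  unfolding is_l2_def
proof (rule summable_comparison_test')
  show "summable (\<lambda>k. 2 * (cmod (f k))\<^sup>2 + 2 * (cmod (g k))\<^sup>2)"
    using assms by (intro summable_add summable_mult) (auto simp: is_l2_def)
  show "norm ((cmod (f k + g k))\<^sup>2) \<le> 2 * (cmod (f k))\<^sup>2 + 2 * (cmod (g k))\<^sup>2" for k
  proof -
    have "(cmod (f k + g k))\<^sup>2 \<le> (cmod (f k) + cmod (g k))\<^sup>2"
      by (intro power_mono norm_triangle_ineq) auto
    also have "\<dots> \<le> 2 * (cmod (f k))\<^sup>2 + 2 * (cmod (g k))\<^sup>2"
      using sum_squares_bound[of "cmod (f k)" "cmod (g k)"] by (simp add: power2_sum)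
    finally show ?thesis by simp
  qed
qed

lemma is_l2_cmult:
  assumes "is_l2 f"
  shows "is_l2 (\<lambda>k. c * f k)"
  using assms summable_mult[of "\<lambda>k. (cmod (f k))\<^sup>2" "(cmod c)\<^sup>2"]
  by (simp add: is_l2_def norm_mult power_mult_distrib)

text \<open>Since \<open>l2_linear\<close> only speaks of square-summable arguments, membership in
  l2 is carried along in the induction.\<close>

lemma l2_linear_sum:
  assumes T: "l2_linear T" and h: "\<And>n. n \<in> M \<Longrightarrow> is_l2 (h n)" and M: "finite M"
  shows "is_l2 (\<lambda>k. \<Sum>n\<in>M. c n * h n k) \<and> T (\<lambda>k. \<Sum>n\<in>M. c n * h n k) = (\<lambda>k. \<Sum>n\<in>M. c n * T (h n) k)"
  using M h
proof (induction M)
  case empty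
  have "T (\<lambda>k. 0 * (\<lambda>_. 0) k) = (\<lambda>k. 0 * T (\<lambda>_. 0) k)"
    using T is_l2_zero unfolding l2_linear_def by blast
  then show ?case by simp
next
  case (insert x M)
  let ?g = "\<lambda>k. \<Sum>n\<in>M. c n * h n k"
  have IH: "is_l2 ?g" "T ?g = (\<lambda>k. \<Sum>n\<in>M. c n * T (h n) k)" using insert by auto
  have hx: "is_l2 (h x)" using insert by simp
  have "T (\<lambda>k. c x * h x k + ?g k) = (\<lambda>k. T (\<lambda>k. c x * h x k) k + T ?g k)"
    using T is_l2_cmult[OF hx] IH(1) unfolding l2_linear_def by blast
  moreover have "T (\<lambda>k. c x * h x k) = (\<lambda>k. c x * T (h x) k)"
    using T hx unfolding l2_linear_def by blast
  ultimately show ?case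
    using insert(1,2) IH is_l2_add[OF is_l2_cmult[OF hx, of "c x"] IH(1)] by simp
qed

text \<open>Rescaling to a unit vector turns the estimate at f into one for the norm. A competitor P
  in \<open>approx_num\<close> may map outside l2, so T f may fail to be square-summable; then its
  \<open>l2norm\<close> is infinite and the bound holds as well.\<close>

lemma op_norm_ge:
  assumes f: "is_l2 f" and pos: "0 < (\<Sum>k. (cmod (f k))\<^sup>2)" and l: "0 \<le> l"
    and hom: "\<And>c. T (\<lambda>k. c * f k) = (\<lambda>k. c * T f k)"
    and ge: "is_l2 (T f) \<Longrightarrow> l\<^sup>2 * (\<Sum>k. (cmod (f k))\<^sup>2) \<le> (\<Sum>k. (cmod (T f k))\<^sup>2)"
  shows "ereal l \<le> op_norm T"
proof -
  define S where "S = (\<Sum>k. (cmod (f k))\<^sup>2)"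
  have S: "0 < S" using pos by (simp add: S_def)
  define c where "c = complex_of_real (1 / sqrt S)"
  have c2: "(cmod c)\<^sup>2 = 1 / S" and c0: "c \<noteq> 0"
    using S by (auto simp: c_def norm_divide power_divide)
  have scale: "(\<lambda>k. (cmod (c * g k))\<^sup>2) = (\<lambda>k. (1 / S) * (cmod (g k))\<^sup>2)" for g
    by (simp add: norm_mult power_mult_distrib c2)
  have fs: "summable (\<lambda>k. (cmod (f k))\<^sup>2)" using f by (simp add: is_l2_def)
  have "(\<Sum>k. (cmod (c * f k))\<^sup>2) = 1"
    unfolding scale using S by (subst suminf_mult[OF fs]) (simp add: S_def)
  then have unit: "is_l2 (\<lambda>k. c * f k)" "l2norm (\<lambda>k. c * f k) \<le> 1"
    using is_l2_cmult[OF f] by (auto simp: l2norm_def)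
  have "ereal l \<le> l2norm (T (\<lambda>k. c * f k))"
  proof (cases "is_l2 (T (\<lambda>k. c * f k))")
    case True
    then have "is_l2 (\<lambda>k. (1 / c) * (c * T f k))" unfolding hom by (rule is_l2_cmult)
    then have Tf: "is_l2 (T f)" using c0 by simp
    then have Ts: "summable (\<lambda>k. (cmod (T f k))\<^sup>2)" by (simp add: is_l2_def)
    have "(\<Sum>k. (cmod (c * T f k))\<^sup>2) = (1 / S) * (\<Sum>k. (cmod (T f k))\<^sup>2)"
      unfolding scale by (rule suminf_mult[OF Ts])
    also have "\<dots> \<ge> (1 / S) * (l\<^sup>2 * S)"
      using ge[OF Tf] S by (intro mult_left_mono) (auto simp: S_def)
    finally have "l \<le> sqrt (\<Sum>k. (cmod (c * T f k))\<^sup>2)" using S by (intro real_le_rsqrt) simp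
    then show ?thesis using True unfolding hom by (simp add: l2norm_def)
  next
    case False
    then show ?thesis by (simp add: l2norm_def)
  qed
  also have "\<dots> \<le> op_norm T" unfolding op_norm_def using unit by (intro SUP_upper) auto
  finally show ?thesis .
qed

text \<open>The factor \<open>1/4\<close> makes the entries sum to zero, so that the image under a Rhaly operator
  is supported in the same three consecutive dyadic blocks.\<close>

definition test_vector :: "nat \<Rightarrow> nat \<Rightarrow> complex" where
  "test_vector n k = of_bool (k \<in> {2 ^ n..<2 ^ (n + 1)}) - of_bool (k \<in> {2 ^ (n + 2)..<2 ^ (n + 3)}) / 4"

lemma test_vector_eq_0:
  assumes "k \<notin> {2 ^ n..<2 ^ (n + 3)}"
  shows "test_vector n k = 0"
proof -
  have "(2::nat) ^ n \<le> 2 ^ (n + 2)" "(2::nat) ^ (n + 1) \<le> 2 ^ (n + 3)"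
    by (intro power_increasing; simp)+
  then show ?thesis using assms by (auto simp: test_vector_def)
qed

lemma sum_of_bool_mem:
  assumes "finite A"
  shows "(\<Sum>k\<in>A. of_bool (k \<in> B)) = (of_nat (card (A \<inter> B)) :: 'a::semiring_1)"
  using assms by (simp add: of_bool_def sum.If_cases)

lemma test_vector_partial_sum:
  "(\<Sum>j\<le>k. test_vector n j) =
     of_nat (card ({..k} \<inter> {2 ^ n..<2 ^ (n + 1)})) - of_nat (card ({..k} \<inter> {2 ^ (n + 2)..<2 ^ (n + 3)})) / 4"
  unfolding test_vector_def sum_subtractf sum_divide_distrib[symmetric]
  by (simp only: sum_of_bool_mem finite_atMost)

lemma test_vector_partial_sum_eq_0:
  assumes "k \<notin> {2 ^ n..<2 ^ (n + 3)}"
  shows "(\<Sum>j\<le>k. test_vector n j) = 0"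
proof (cases "k < 2 ^ n")
  case True
  then show ?thesis by (intro sum.neutral) (auto intro!: test_vector_eq_0)
next
  case False
  have "(2::nat) ^ (n + 1) \<le> 2 ^ (n + 3)" by (intro power_increasing) auto
  then have "{..k} \<inter> {2 ^ n..<2 ^ (n + 1)} = {2 ^ n..<2 ^ (n + 1)}"
    "{..k} \<inter> {2 ^ (n + 2)..<2 ^ (n + 3)} = {2 ^ (n + 2)..<2 ^ (n + 3)}"
    using False assms by auto
  then show ?thesis unfolding test_vector_partial_sum by (simp add: power_add)
qed

text \<open>Between the two blocks of the support the partial sums stay at the size 2^n of the first
  block; there the Rhaly operator reproduces \<alpha> scaled by 2^n, which yields the energy of
  block n + 1.\<close>

lemma test_vector_partial_sum_middle:
  assumes "k \<in> {2 ^ (n + 1)..<2 ^ (n + 2)}"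
  shows "(\<Sum>j\<le>k. test_vector n j) = 2 ^ n"
proof -
  have "{..k} \<inter> {2 ^ n..<2 ^ (n + 1)} = {2 ^ n..<2 ^ (n + 1)}"
    "{..k} \<inter> {2 ^ (n + 2)..<2 ^ (n + 3)} = {}" using assms by auto
  then show ?thesis unfolding test_vector_partial_sum by (simp del: power_Suc) simp
qed

lemma test_vector_norm: "(\<Sum>k\<in>{2 ^ n..<2 ^ (n + 3)}. (cmod (test_vector n k))\<^sup>2) \<le> 2 ^ (n + 1)"
proof -
  let ?A = "{2 ^ n..<2 ^ (n + 1)} :: nat set" and ?B = "{2 ^ (n + 2)..<2 ^ (n + 3)} :: nat set"
  have sub: "?A \<subseteq> {2 ^ n..<2 ^ (n + 3)}" "?B \<subseteq> {2 ^ n..<2 ^ (n + 3)}" "?A \<inter> ?B = {}"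
    by (auto simp: power_add)
  have "(cmod (test_vector n k))\<^sup>2 = of_bool (k \<in> ?A) + of_bool (k \<in> ?B) / 16" for k
    using sub(3) by (auto simp: test_vector_def power_divide norm_divide)
  then have "(\<Sum>k\<in>{2 ^ n..<2 ^ (n + 3)}. (cmod (test_vector n k))\<^sup>2)
      = (\<Sum>k\<in>{2 ^ n..<2 ^ (n + 3)}. of_bool (k \<in> ?A)) + (\<Sum>k\<in>{2 ^ n..<2 ^ (n + 3)}. of_bool (k \<in> ?B)) / 16"
    by (simp only: sum.distrib sum_divide_distrib)
  also have "(\<Sum>k\<in>{2 ^ n..<2 ^ (n + 3)}. of_bool (k \<in> ?A)) = real (card ?A)"
    using sub(1) by (simp only: sum_of_bool_mem finite_atLeastLessThan Int_absorb1)
  also have "(\<Sum>k\<in>{2 ^ n..<2 ^ (n + 3)}. of_bool (k \<in> ?B)) = real (card ?B)"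
    using sub(2) by (simp only: sum_of_bool_mem finite_atLeastLessThan Int_absorb1)
  also have "real (card ?A) + real (card ?B) / 16 = 2 ^ n + 2 ^ n / 4" by (simp add: power_add)
  also have "\<dots> \<le> (2 ^ (n + 1) :: real)" by simp
  finally show ?thesis .
qed

text \<open>Some nontrivial combination f of the card M test vectors is annihilated by P, whose rank
  is below card M, so on f the error is the Rhaly operator itself. The gap of 3 between indices
  makes the supports disjoint and reduces the estimate to single test vectors.\<close>

lemma approx_num_rhaly_ge:
  assumes M: "finite M" "M \<noteq> {}"
    and sep: "\<And>n m. n \<in> M \<Longrightarrow> m \<in> M \<Longrightarrow> n < m \<Longrightarrow> n + 3 \<le> m"
    and l: "0 \<le> l" and big: "\<And>n. n \<in> M \<Longrightarrow> l\<^sup>2 \<le> dyadic_energy \<alpha> (n + 1)"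
  shows "ereal (l / 2) \<le> approx_num (card M) (rhaly \<alpha>)"
  unfolding approx_num_def
proof (rule INF_greatest)
  fix P assume "P \<in> {P. l2_linear P \<and> rank_le P (card M - 1)}"
  then have P: "l2_linear P" and rank: "rank_le P (card M - 1)" by auto
  let ?N = "card M - 1"
  let ?h = "test_vector"
  let ?I = "\<lambda>n. {2 ^ n..<2 ^ (n + 3)} :: nat set"
  have h: "is_l2 (?h n)" for n
    by (rule is_l2_finite_support(1)[of "?I n"]) (auto intro: test_vector_eq_0)
  obtain v where v: "\<forall>f. is_l2 f \<longrightarrow> (\<exists>c. P f = (\<lambda>k. \<Sum>i<?N. c i * v i k))"
    using rank unfolding rank_le_def by blast
  then have "\<forall>n. \<exists>c. P (?h n) = (\<lambda>k. \<Sum>i<?N. c i * v i k)" using h by blast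
  \<comment> \<open>The numbers A n i are coordinates of the images of the test vectors with respect
    to v, so annihilation amounts to card M - 1 equations in card M unknowns.\<close>
  from choice[OF this] obtain A where A: "\<And>n. P (?h n) = (\<lambda>k. \<Sum>i<?N. A n i * v i k)" by blast
  have "?N < card M" using M by (simp add: card_gt_0_iff)
  from homogeneous_system_nontrivial[OF M(1) this, of A]
  obtain c where c: "\<exists>n\<in>M. c n \<noteq> 0" "\<forall>i<?N. (\<Sum>n\<in>M. c n * A n i) = 0" by blast
  define f where "f = (\<lambda>k. \<Sum>n\<in>M. c n * ?h n k)"
  have f: "is_l2 f" "P f = (\<lambda>k. \<Sum>n\<in>M. c n * P (?h n) k)" "rhaly \<alpha> f = (\<lambda>k. \<Sum>n\<in>M. c n * rhaly \<alpha> (?h n) k)"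
    unfolding f_def using l2_linear_sum[where h = ?h and c = c, OF P h M(1)]
      l2_linear_sum[where h = ?h and c = c, OF l2_linear_rhaly h M(1)] by blast+
  have Pf: "P f k = 0" for k
  proof -
    have "P f k = (\<Sum>n\<in>M. \<Sum>i<?N. c n * A n i * v i k)"
      unfolding f(2) A by (simp add: sum_distrib_left mult.assoc)
    also have "\<dots> = (\<Sum>i<?N. (\<Sum>n\<in>M. c n * A n i) * v i k)"
      by (subst sum.swap) (simp add: sum_distrib_right)
    also have "\<dots> = 0" using c(2) by simp
    finally show ?thesis .
  qed
  have disj: "n = m" if "n \<in> M" "m \<in> M" "k \<in> ?I n" "k \<in> ?I m" for n m k
  proof -
    have "\<not> n < m" if "n \<in> M" "m \<in> M" "k \<in> ?I n" "k \<in> ?I m" for n m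
    proof
      assume "n < m"
      then have "(2::nat) ^ (n + 3) \<le> 2 ^ m" using sep that by (intro power_increasing) auto
      then have "k < k" using that(3,4) by (meson atLeastLessThan_iff le_trans less_le_trans)
      then show False by simp
    qed
    then show ?thesis using that by (metis linorder_neqE_nat)
  qed
  have pick: "(\<Sum>n\<in>M. c n * g n k) = c m * g m k"
    if "m \<in> M" "k \<in> ?I m" and z: "\<And>n. k \<notin> ?I n \<Longrightarrow> g n k = 0" for g :: "nat \<Rightarrow> nat \<Rightarrow> complex" and m k
  proof -
    have "(\<Sum>n\<in>M. c n * g n k) = (\<Sum>n\<in>{m}. c n * g n k)"
    proof (rule sum.mono_neutral_right)
      show "\<forall>n\<in>M - {m}. c n * g n k = 0" using disj that(1,2) z by fastforce
    qed (use M that in auto)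
    then show ?thesis by simp
  qed
  have Rz: "rhaly \<alpha> (?h n) k = 0" if "k \<notin> ?I n" for n k
    using test_vector_partial_sum_eq_0[OF that] by (simp add: rhaly_def)
  let ?U = "\<Union>n\<in>M. ?I n"
  have blocks: "(\<Sum>k\<in>?U. g k) = (\<Sum>n\<in>M. \<Sum>k\<in>?I n. g k)" for g :: "nat \<Rightarrow> real"
  proof (rule sum.UNION_disjoint[OF M(1)])
    show "\<forall>n\<in>M. \<forall>m\<in>M. n \<noteq> m \<longrightarrow> ?I n \<inter> ?I m = {}" using disj by blast
  qed simp
  have U: "finite ?U" using M(1) by simp
  have fz: "f k = 0" if "k \<notin> ?U" for k
    using that test_vector_eq_0 unfolding f_def by (intro sum.neutral) auto
  have Rfz: "rhaly \<alpha> f k = 0" if "k \<notin> ?U" for k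
    using that Rz unfolding f(3) by (intro sum.neutral) auto
  have "(\<Sum>k. (cmod (f k))\<^sup>2) = (\<Sum>n\<in>M. \<Sum>k\<in>?I n. (cmod (f k))\<^sup>2)"
    unfolding blocks[symmetric] by (rule is_l2_finite_support(2)[OF U fz])
  also have "\<dots> = (\<Sum>n\<in>M. (cmod (c n))\<^sup>2 * (\<Sum>k\<in>?I n. (cmod (?h n k))\<^sup>2))"
    unfolding sum_distrib_left f_def using pick[of _ _ ?h] test_vector_eq_0
    by (intro sum.cong refl) (simp add: norm_mult power_mult_distrib)
  finally have normf: "(\<Sum>k. (cmod (f k))\<^sup>2) = (\<Sum>n\<in>M. (cmod (c n))\<^sup>2 * (\<Sum>k\<in>?I n. (cmod (?h n k))\<^sup>2))" .
  have "(\<Sum>k. (cmod (rhaly \<alpha> f k))\<^sup>2) = (\<Sum>n\<in>M. \<Sum>k\<in>?I n. (cmod (rhaly \<alpha> f k))\<^sup>2)"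
    unfolding blocks[symmetric] by (rule is_l2_finite_support(2)[OF U Rfz])
  also have "\<dots> = (\<Sum>n\<in>M. (cmod (c n))\<^sup>2 * (\<Sum>k\<in>?I n. (cmod (rhaly \<alpha> (?h n) k))\<^sup>2))"
    unfolding sum_distrib_left f(3) using pick[of _ _ "\<lambda>n. rhaly \<alpha> (?h n)"] Rz
    by (intro sum.cong refl) (simp add: norm_mult power_mult_distrib)
  finally have normRf: "(\<Sum>k. (cmod (rhaly \<alpha> f k))\<^sup>2)
      = (\<Sum>n\<in>M. (cmod (c n))\<^sup>2 * (\<Sum>k\<in>?I n. (cmod (rhaly \<alpha> (?h n) k))\<^sup>2))" .
  have each: "(l / 2)\<^sup>2 * (\<Sum>k\<in>?I n. (cmod (?h n k))\<^sup>2) \<le> (\<Sum>k\<in>?I n. (cmod (rhaly \<alpha> (?h n) k))\<^sup>2)" if "n \<in> M" for n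
  proof -
    \<comment> \<open>The 2^(n+1) from the norm of the test vector and the 2^(n+1) in the block
      energy combine to 4 * (2^n)^2, and this 4 cancels against the square of l/2.\<close>
    let ?J = "{2 ^ (n + 1)..<2 ^ (n + 2)} :: nat set"
    have "(l / 2)\<^sup>2 * (\<Sum>k\<in>?I n. (cmod (?h n k))\<^sup>2) \<le> (l / 2)\<^sup>2 * 2 ^ (n + 1)"
      by (intro mult_left_mono test_vector_norm) simp
    also have "\<dots> = l\<^sup>2 * 2 ^ (n + 1) / 4" by (simp add: power_divide)
    also have "\<dots> \<le> dyadic_energy \<alpha> (n + 1) * 2 ^ (n + 1) / 4"
      using big[OF that] by (intro divide_right_mono mult_right_mono) auto
    also have "\<dots> = (\<Sum>k\<in>?J. (cmod (\<alpha> k))\<^sup>2 * (2 ^ n)\<^sup>2)"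
      by (simp add: dyadic_energy_def sum_distrib_left sum_distrib_right power2_eq_square mult_ac)
    also have "\<dots> = (\<Sum>k\<in>?J. (cmod (rhaly \<alpha> (?h n) k))\<^sup>2)"
      using test_vector_partial_sum_middle[of _ n]
      by (intro sum.cong refl) (simp add: rhaly_def norm_mult norm_power power_mult_distrib)
    also have "\<dots> \<le> (\<Sum>k\<in>?I n. (cmod (rhaly \<alpha> (?h n) k))\<^sup>2)"
      by (intro sum_mono2) (auto simp: power_add)
    finally show ?thesis .
  qed
  show "ereal (l / 2) \<le> op_norm (\<lambda>f k. rhaly \<alpha> f k - P f k)"
  proof (rule op_norm_ge[OF f(1)])
    \<comment> \<open>The test vector with index m equals 1 at 2^m, and disjointness of the supports
      rules out cancellation, so f is nonzero.\<close>
    obtain m where m: "m \<in> M" "c m \<noteq> 0" using c(1) by blast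
    have "0 < (cmod (c m))\<^sup>2 * (\<Sum>k\<in>{2 ^ m}. (cmod (?h m k))\<^sup>2)"
      using m by (simp add: test_vector_def power_add)
    also have "\<dots> \<le> (cmod (c m))\<^sup>2 * (\<Sum>k\<in>?I m. (cmod (?h m k))\<^sup>2)"
      by (intro mult_left_mono sum_mono2) (auto simp: power_add)
    also have "\<dots> \<le> (\<Sum>k. (cmod (f k))\<^sup>2)"
      unfolding normf using M(1) m
      by (intro member_le_sum[where f = "\<lambda>n. (cmod (c n))\<^sup>2 * (\<Sum>k\<in>?I n. (cmod (?h n k))\<^sup>2)"]
          mult_nonneg_nonneg sum_nonneg) auto
    finally show "0 < (\<Sum>k. (cmod (f k))\<^sup>2)" .
    show "0 \<le> l / 2" using l by simp
    show "(\<lambda>k. rhaly \<alpha> (\<lambda>k. c * f k) k - P (\<lambda>k. c * f k) k) = (\<lambda>k. c * (rhaly \<alpha> f k - P f k))" for c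
    proof -
      have "P (\<lambda>k. c * f k) = (\<lambda>k. c * P f k)" "rhaly \<alpha> (\<lambda>k. c * f k) = (\<lambda>k. c * rhaly \<alpha> f k)"
        using P l2_linear_rhaly f(1) unfolding l2_linear_def by blast+
      then show ?thesis by (simp add: right_diff_distrib)
    qed
    show "(l / 2)\<^sup>2 * (\<Sum>k. (cmod (f k))\<^sup>2) \<le> (\<Sum>k. (cmod (rhaly \<alpha> f k - P f k))\<^sup>2)"
    proof -
      have "(l / 2)\<^sup>2 * (\<Sum>k. (cmod (f k))\<^sup>2)
          = (\<Sum>n\<in>M. (cmod (c n))\<^sup>2 * ((l / 2)\<^sup>2 * (\<Sum>k\<in>?I n. (cmod (?h n k))\<^sup>2)))"
        unfolding normf sum_distrib_left by (intro sum.cong refl) (simp add: mult_ac)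
      also have "\<dots> \<le> (\<Sum>k. (cmod (rhaly \<alpha> f k))\<^sup>2)"
        unfolding normRf by (intro sum_mono mult_left_mono each) auto
      finally show ?thesis by (simp add: Pf)
    qed
  qed
qed

text \<open>Within a residue class modulo 3 the N-th largest root energy is matched with the N-th
  approximation number. The finite form \<open>key\<close> removes the smallest one at each step,
  which avoids sorting, and it bounds all partial sums.\<close>

theorem dyadic_summable_if_schatten_rhaly:
  assumes q: "0 < q" and S: "schatten q (rhaly \<alpha>)"
  shows "summable (\<lambda>n. dyadic_energy \<alpha> n powr (q / 2))"
proof -
  define a where "a = (\<lambda>k. real_of_ereal (approx_num (Suc k) (rhaly \<alpha>)))"
  \<comment> \<open>The test vector with index n detects block n + 1, hence the shift; block 0 is
    restored at the end as a single term.\<close>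
  define s where "s = (\<lambda>n. sqrt (dyadic_energy \<alpha> (n + 1)))"
  have s0: "0 \<le> s n" for n by (simp add: s_def)
  have a0: "0 \<le> a k" for k unfolding a_def by (intro real_of_ereal_pos approx_num_nonneg)
  have as: "summable (\<lambda>k. a k powr q)" and fin: "op_norm (rhaly \<alpha>) < \<infinity>"
    using S by (auto simp: schatten_def a_def bounded_l2_op_def)
  have key: "(\<Sum>n\<in>M. s n powr q) \<le> 2 powr q * (\<Sum>k<card M. a k powr q)"
    if "finite M" "\<And>n m. n \<in> M \<Longrightarrow> m \<in> M \<Longrightarrow> n < m \<Longrightarrow> n + 3 \<le> m" for M
    using that
  proof (induction "card M" arbitrary: M)
    case 0
    then show ?case by simp
  next
    case (Suc k)
    then have ne: "M \<noteq> {}" by auto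
    \<comment> \<open>All card M = k + 1 root energies are at least the smallest one, which is
      therefore at most 2 a(k).\<close>
    define m where "m = arg_min_on s M"
    have m: "m \<in> M" and min: "\<And>n. n \<in> M \<Longrightarrow> s m \<le> s n"
      using arg_min_if_finite[OF Suc.prems(1) ne, of s] by (auto simp: m_def not_less)
    have card: "card (M - {m}) = k" using Suc m by simp
    have "(\<Sum>n\<in>M - {m}. s n powr q) \<le> 2 powr q * (\<Sum>k<card (M - {m}). a k powr q)"
      using Suc.hyps(1)[of "M - {m}"] card Suc.prems by auto
    moreover have "s m powr q \<le> 2 powr q * a k powr q"
    proof -
      have "ereal (s m / 2) \<le> approx_num (card M) (rhaly \<alpha>)"
      proof (rule approx_num_rhaly_ge[OF Suc.prems(1) ne Suc.prems(2) s0])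
        fix n assume "n \<in> M"
        then have "(s m)\<^sup>2 \<le> (s n)\<^sup>2" using min s0 by (intro power_mono) auto
        then show "(s m)\<^sup>2 \<le> dyadic_energy \<alpha> (n + 1)" by (simp add: s_def)
      qed
      then have ge: "ereal (s m / 2) \<le> approx_num (Suc k) (rhaly \<alpha>)" using Suc.hyps(2) by simp
      \<comment> \<open>Finiteness matters because \<open>real_of_ereal\<close> sends infinity to
        0.\<close>
      have "approx_num (Suc k) (rhaly \<alpha>) < \<infinity>" by (rule le_less_trans[OF approx_num_le_op_norm fin])
      then have "s m / 2 \<le> a k"
        using ge approx_num_nonneg[of "Suc k" "rhaly \<alpha>"] unfolding a_def
        by (cases "approx_num (Suc k) (rhaly \<alpha>)") auto
      then have "s m powr q \<le> (2 * a k) powr q" using s0 q by (intro powr_mono2) auto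
      then show ?thesis using a0 by (simp add: powr_mult)
    qed
    moreover have "(\<Sum>n\<in>M. s n powr q) = s m powr q + (\<Sum>n\<in>M - {m}. s n powr q)"
      by (rule sum.remove[OF Suc.prems(1) m])
    moreover have "(\<Sum>i<card M. a i powr q) = (\<Sum>i<k. a i powr q) + a k powr q"
      using Suc.hyps(2) by (metis sum.lessThan_Suc)
    ultimately show ?case unfolding card by (simp add: distrib_left)
  qed
  define B where "B = 2 powr q * (\<Sum>k. a k powr q)"
  have class_bound: "(\<Sum>n | n < N \<and> n mod 3 = r. s n powr q) \<le> B" for N r
  proof -
    let ?M = "{n. n < N \<and> n mod 3 = r}"
    have "n + 3 \<le> m" if "n \<in> ?M" "m \<in> ?M" "n < m" for n m
      using that by simp presburger
    then have "(\<Sum>n\<in>?M. s n powr q) \<le> 2 powr q * (\<Sum>k<card ?M. a k powr q)"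
      by (intro key) auto
    also have "\<dots> \<le> B"
      unfolding B_def using as by (intro mult_left_mono sum_le_suminf) auto
    finally show ?thesis .
  qed
  have "(\<Sum>n<N. s n powr q) \<le> 3 * B" for N
  proof -
    have "(\<Sum>n<N. s n powr q) = (\<Sum>r<3. \<Sum>n | n \<in> {..<N} \<and> n mod 3 = r. s n powr q)"
      by (rule sum.group[symmetric]) auto
    also have "\<dots> \<le> (\<Sum>r<(3::nat). B)" using class_bound by (intro sum_mono) auto
    finally show ?thesis by simp
  qed
  then have "summable (\<lambda>n. s n powr q)" by (intro summableI_nonneg_bounded) auto
  moreover have "s n powr q = dyadic_energy \<alpha> (Suc n) powr (q / 2)" for n
    by (simp add: s_def powr_half_sqrt[symmetric] powr_powr)
  ultimately show ?thesis
    using summable_Suc_iff[of "\<lambda>n. dyadic_energy \<alpha> n powr (q / 2)"] by simp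
qed

theorem theorem1p3:
  fixes q :: real and \<alpha> :: "nat \<Rightarrow> complex"
  assumes "1 < q" and "is_l2 \<alpha>"
  shows "(schatten q (rhaly \<alpha>) \<longleftrightarrow> besov_half q (\<lambda>z. \<Sum>n. \<alpha> n * z ^ n))
       \<and> (besov_half q (\<lambda>z. \<Sum>n. \<alpha> n * z ^ n) \<longleftrightarrow>
          summable (\<lambda>n. (2 ^ n * (\<Sum>j\<in>{2 ^ n..<2 ^ (n + 1)}. (cmod (\<alpha> j))^2)) powr (q / 2)))"
  using besov_half_iff_dyadic_summable[of q \<alpha>] schatten_rhaly_if_dyadic_summable[of q \<alpha>]
    dyadic_summable_if_schatten_rhaly[of q \<alpha>] assms
  unfolding dyadic_energy_def by auto

end
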